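(* Let $(\Gamma,\mu)$ be a weighted graph satisfying $(p_0)$, $(VD)$ and $(TC)$. Then the following statements are equivalent. 1. The mean value inequality $(MV)$: there is a $C>0$ such that for all $x\in\Gamma$, $R>0$ and all functions $u\ge 0$ harmonic on $B=B(x,R)$, $$u(x)\le \frac{C}{V(x,R)}\sum_{y\in B}u(y)\mu(y).$$ 2. The local diagonal upper estimate $(DUE)$: there is a $C>0$ such that for all $x\in\Gamma$, $n>0$, $$p_n(x,x)\le \frac{C}{V(x,e(x,n))}.$$ 3. The upper estimate $(UE)$: there are $C>0,\ \beta>1,\ c>0$ such that for all $x,y\in\Gamma$, $n>0$, $$p_n(x,y)\le \frac{C}{V(x,e(x,n))}\exp\left[-c\left(\frac{E(x,d(x,y))}{n}\right)^{\frac{1}{\beta-1}}\right].$$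
   Context: Setting. $\Gamma$ is a countable infinite connected graph; $x\sim y$ means that $x,y$ are joined by an edge. Each edge carries a weight $\mu_{x,y}=\mu_{y,x}>0$; $\mu(x)=\sum_{y\sim x}\mu_{x,y}$ and $\mu(A)=\sum_{y\in A}\mu(y)$. The random walk $(X_n)$ on $(\Gamma,\mu)$ is the Markov chain with transition probabilities $P(x,y)=\mu_{x,y}/\mu(x)$; $P_n(x,y)=\mathbb P(X_n=y\mid X_0=x)$ and $p_n(x,y)=P_n(x,y)/\mu(y)$. The time $n$ is an integer. $d(x,y)$ is the graph distance, $B(x,R)=\{y:d(x,y)<R\}$, $V(x,R)=\mu(B(x,R))$. $T_{B(x,R)}=\min\{k: X_k\notin B(x,R)\}$, and $E(x,R)=\mathbb E(T_{B(x,R)}\mid X_0=x)$ is the mean exit time. $e(x,n)=\min\{R\in\mathbb N: E(x,R)\ge n\}$ is the inverse of $E(x,\cdot)$. Conditions. $(p_0)$: there is $p_0>0$ with $\mu_{x,y}/\mu(x)\ge p_0$ for all $x\sim y$. $(VD)$: there is $D_V>0$ with $V(x,2R)\le D_V V(x,R)$ for all $x\in\Gamma,R>0$. $(TC)$: there is $C_T>1$ with $E(x,2R)/E(y,R)\le C_T$ for all $x\in\Gamma$, $R>0$, $y\in B(x,R)$. For $A\subset\Gamma$, $\overline A$ is $A$ together with all vertices adjacent to a vertex of $A$. A function $h$ is harmonic on $A$ if it is defined on $\overline A$ and $\sum_y P(x,y)h(y)=h(x)$ for all $x\in A$. A function $u\ge0$ harmonic on $A$ is nonnegative on $\overline A$.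 *)

theory Defs
  imports "HOL-Probability.Probability"
begin

section \<open>Markov chains on a discrete state space\<close>

text \<open>
  The canonical chain with transition kernel \<open>K\<close> started in \<open>x\<close>: the law on trajectories
  \<open>nat \<Rightarrow> 'a\<close> given by the theorem of Ionescu Tulcea, the coordinates being \<open>X\<^sub>n \<omega> = \<omega> n\<close>.
\<close>

definition chain_kernel :: "('a \<Rightarrow> 'a pmf) \<Rightarrow> 'a \<Rightarrow> nat \<Rightarrow> (nat \<Rightarrow> 'a) \<Rightarrow> 'a measure" where
  "chain_kernel K x n \<omega> = measure_pmf (if n = 0 then return_pmf x else K (\<omega> (n - 1)))"

lemma Ionescu_Tulcea_chain_kernel:
  "Ionescu_Tulcea (chain_kernel K x) (\<lambda>_. count_space UNIV)"
proof (rule Ionescu_Tulcea.intro)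
  show "chain_kernel K x i
      \<in> measurable (PiM {0..<i} (\<lambda>_. count_space UNIV)) (subprob_algebra (count_space UNIV))" for i
  proof (cases i)
    case 0
    have "chain_kernel K x 0 = (\<lambda>_. measure_pmf (return_pmf x))"
      by (rule ext) (simp add: chain_kernel_def)
    then show ?thesis
      unfolding 0 by (simp only:) (rule measurable_const, rule measure_pmf_in_subprob_algebra)
  next
    case (Suc j)
    have "(\<lambda>\<omega>. \<omega> j) \<in> measurable (PiM {0..<Suc j} (\<lambda>_. count_space UNIV)) (count_space UNIV)"
      by (rule measurable_component_singleton) simp
    moreover have "(\<lambda>y. measure_pmf (K y))
        \<in> measurable (count_space UNIV) (subprob_algebra (count_space UNIV))"
      by (simp add: measure_pmf_in_subprob_algebra)
    ultimately show ?thesis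
      using Suc by (simp add: chain_kernel_def[abs_def] measurable_compose)
  qed
next
  show "prob_space (chain_kernel K x i \<omega>)" for i \<omega>
    unfolding chain_kernel_def by (rule measure_pmf.prob_space_axioms)
qed

interpretation IT: Ionescu_Tulcea "chain_kernel K x" "\<lambda>_. count_space UNIV" for K x
  by (rule Ionescu_Tulcea_chain_kernel)

definition markov_chain :: "('a \<Rightarrow> 'a pmf) \<Rightarrow> 'a \<Rightarrow> (nat \<Rightarrow> 'a) measure" where
  "markov_chain K x = IT.PF.lim K x"

lemma space_markov_chain [simp]: "space (markov_chain K x) = UNIV"
  by (simp add: markov_chain_def space_PiM)

lemma sets_markov_chain [simp, measurable_cong]:
  "sets (markov_chain K x) = sets (PiM UNIV (\<lambda>_. count_space UNIV))"
  by (simp add: markov_chain_def)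

text \<open>The finite-dimensional distributions, i.e. the Markov property.\<close>

lemma markov_chain_fdd:
  "emeasure (markov_chain K x) {\<omega>. \<forall>i\<le>n. \<omega> i = v i} =
     indicator {v 0} x * (\<Prod>i<n. ennreal (pmf (K (v i)) (v (Suc i))))"
proof -
  let ?M = "\<lambda>_::nat. count_space (UNIV :: 'a set)"
  define S where "S m = PiE {0..<m} (\<lambda>i. {v i})" for m
  have S_sets [measurable]: "S m \<in> sets (PiM {0..<m} ?M)" for m
    unfolding S_def by (intro sets_PiM_I_finite) auto
  have S_Suc: "S m = {restrict v {0..<m}}" for m
    unfolding S_def by (auto simp: PiE_iff extensional_def restrict_def fun_eq_iff)
  have step: "emeasure (IT.C K x 0 (Suc m) (\<lambda>_. undefined)) (S (Suc m)) =
      emeasure (IT.C K x 0 m (\<lambda>_. undefined)) (S m) *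
      emeasure (chain_kernel K x m (restrict v {0..<m})) {v m}" for m
  proof -
    have sC: "sets (IT.C K x 0 m (\<lambda>_. undefined)) = sets (PiM {0..<m} ?M)"
      using IT.sets_C[of "\<lambda>_. undefined" 0 K x m] by simp
    have spC: "space (IT.C K x 0 m (\<lambda>_. undefined)) = space (PiM {0..<m} ?M)"
      using sets_eq_imp_space_eq[OF sC] .
    have eP: "IT.eP K x m \<in> measurable (IT.C K x 0 m (\<lambda>_. undefined))
        (subprob_algebra (PiM {0..<Suc m} ?M))"
      using IT.measurable_eP[of K x m] measurable_cong_sets[OF sC refl] by blast
    have ne: "space (IT.C K x 0 m (\<lambda>_. undefined)) \<noteq> {}"
      unfolding spC by (simp add: space_PiM PiE_eq_empty_iff)
    have "emeasure (IT.C K x 0 (Suc m) (\<lambda>_. undefined)) (S (Suc m)) =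
        (\<integral>\<^sup>+\<omega>. emeasure (IT.eP K x m \<omega>) (S (Suc m)) \<partial>IT.C K x 0 m (\<lambda>_. undefined))"
      using emeasure_bind[OF ne eP S_sets[of "Suc m"]] by simp
    also have "\<dots> = (\<integral>\<^sup>+\<omega>. emeasure (chain_kernel K x m (restrict v {0..<m})) {v m} *
        indicator (S m) \<omega> \<partial>IT.C K x 0 m (\<lambda>_. undefined))"
    proof (rule nn_integral_cong)
      fix \<omega> assume "\<omega> \<in> space (IT.C K x 0 m (\<lambda>_. undefined))"
      then have \<omega>: "\<omega> \<in> space (PiM {0..<m} ?M)"
        by (simp add: spC)
      then have ext: "\<omega> i = undefined" if "\<not> i < m" for i
        using that by (auto simp: space_PiM PiE_iff extensional_def)
      have "fun_upd \<omega> m y \<in> S (Suc m) \<longleftrightarrow> \<omega> \<in> S m \<and> y = v m" for y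
      proof
        assume "fun_upd \<omega> m y \<in> S (Suc m)"
        then have *: "(fun_upd \<omega> m y) i = v i" if "i < Suc m" for i
          using that by (auto simp: S_def PiE_iff)
        have "\<omega> i = v i" if "i < m" for i
          using *[of i] that by simp
        with *[of m] ext show "\<omega> \<in> S m \<and> y = v m"
          by (auto simp: S_def PiE_iff extensional_def)
      next
        assume "\<omega> \<in> S m \<and> y = v m"
        then show "fun_upd \<omega> m y \<in> S (Suc m)"
          by (auto simp: S_def PiE_iff extensional_def less_Suc_eq)
      qed
      then have "fun_upd \<omega> m -` S (Suc m) \<inter> UNIV = (if \<omega> \<in> S m then {v m} else {})"
        by auto
      then show "emeasure (IT.eP K x m \<omega>) (S (Suc m)) =
          emeasure (chain_kernel K x m (restrict v {0..<m})) {v m} * indicator (S m) \<omega>"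
        using IT.emeasure_eP[OF \<omega> S_sets[of "Suc m"], of K x] by (auto simp: S_Suc)
    qed
    also have "\<dots> = emeasure (IT.C K x 0 m (\<lambda>_. undefined)) (S m) *
        emeasure (chain_kernel K x m (restrict v {0..<m})) {v m}"
      by (subst nn_integral_cmult_indicator) (simp_all add: sC S_sets mult.commute)
    finally show ?thesis .
  qed
  have C0: "emeasure (IT.C K x 0 0 (\<lambda>_. undefined)) (S 0) = 1"
    using S_sets[of 0] by (simp add: S_def)
  have C: "emeasure (IT.C K x 0 (Suc m) (\<lambda>_. undefined)) (S (Suc m)) =
      indicator {v 0} x * (\<Prod>i<m. ennreal (pmf (K (v i)) (v (Suc i))))" for m
  proof (induction m)
    case 0
    then show ?case
      by (subst step) (auto simp: C0[simplified] chain_kernel_def emeasure_pmf_single split: split_indicator)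
  next
    case (Suc m)
    show ?case
      by (subst step, subst Suc)
         (simp add: chain_kernel_def emeasure_pmf_single mult.assoc)
  qed
  have "{\<omega>. \<forall>i\<le>n. \<omega> i = v i} = IT.PF.emb UNIV {0..<Suc n} (S (Suc n))"
    by (auto simp: prod_emb_iff S_def PiE_iff less_Suc_eq_le)
  then have "emeasure (markov_chain K x) {\<omega>. \<forall>i\<le>n. \<omega> i = v i} =
      emeasure (IT.CI K x {0..<Suc n}) (S (Suc n))"
    unfolding markov_chain_def using IT.lim[of "{0..<Suc n}" "S (Suc n)" K x] by simp
  also have "\<dots> = emeasure (IT.C K x 0 (Suc n) (\<lambda>_. undefined)) (S (Suc n))"
    by (subst IT.emeasure_CI[of _ "Suc n"]) (simp_all add: prod_emb_id S_def)
  finally show ?thesis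
    unfolding C .
qed

text \<open>First exit time from \<open>A\<close>; the infimum of the empty set is \<open>\<infinity>\<close>.\<close>

definition exit_time :: "'a set \<Rightarrow> (nat \<Rightarrow> 'a) \<Rightarrow> enat" where
  "exit_time A \<omega> = (INF k\<in>{k. \<omega> k \<notin> A}. enat k)"


section \<open>Weighted graphs\<close>

text \<open>
  The vertex set is the whole type \<open>'a\<close>.  Loops are allowed.  Finiteness of \<open>\<mu>(x)\<close>, without
  which the transition probabilities make no sense, is the assumption \<open>weight_summable\<close>; the
  values of \<open>weight\<close> on non-adjacent pairs are never used.
\<close>

locale weighted_graph =
  fixes adj :: "'a \<Rightarrow> 'a \<Rightarrow> bool" and weight :: "'a \<Rightarrow> 'a \<Rightarrow> real"
  assumes countable_vertices: "countable (UNIV :: 'a set)"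
    and infinite_vertices: "infinite (UNIV :: 'a set)"
    and adj_sym: "adj x y \<Longrightarrow> adj y x"
    and connected: "adj\<^sup>*\<^sup>* x y"
    and weight_sym: "adj x y \<Longrightarrow> weight x y = weight y x"
    and weight_pos: "adj x y \<Longrightarrow> weight x y > 0"
    and weight_summable: "weight x summable_on {y. adj x y}"
begin

definition mu :: "'a \<Rightarrow> real" where
  "mu x = (\<Sum>\<^sub>\<infinity>y\<in>{y. adj x y}. weight x y)"

definition trans_prob :: "'a \<Rightarrow> 'a \<Rightarrow> real" where
  "trans_prob x y = (if adj x y then weight x y / mu x else 0)"

definition walk :: "'a \<Rightarrow> (nat \<Rightarrow> 'a) measure" where
  "walk x = markov_chain (\<lambda>z. embed_pmf (trans_prob z)) x"

definition P :: "nat \<Rightarrow> 'a \<Rightarrow> 'a \<Rightarrow> real" where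
  "P n x y = \<P>(\<omega> in walk x. \<omega> n = y)"

definition p :: "nat \<Rightarrow> 'a \<Rightarrow> 'a \<Rightarrow> real" where
  "p n x y = P n x y / mu y"

definition gdist :: "'a \<Rightarrow> 'a \<Rightarrow> nat" where
  "gdist x y = (LEAST n. (adj ^^ n) x y)"

definition gball :: "'a \<Rightarrow> real \<Rightarrow> 'a set" where
  "gball x R = {y. real (gdist x y) < R}"

text \<open>
  Balls are finite under \<open>(p\<^sub>0)\<close> below, so that the sums over balls are then finite sums and
  the mean exit times are finite.
\<close>

definition V :: "'a \<Rightarrow> real \<Rightarrow> real" where
  "V x R = (\<Sum>\<^sub>\<infinity>y\<in>gball x R. mu y)"

definition E :: "'a \<Rightarrow> real \<Rightarrow> ennreal" where
  "E x R = (\<integral>\<^sup>+\<omega>. ennreal_of_enat (exit_time (gball x R) \<omega>) \<partial>walk x)"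

definition e :: "'a \<Rightarrow> nat \<Rightarrow> nat" where
  "e x n = (LEAST R. E x (real R) \<ge> of_nat n)"

definition p0 :: bool where
  "p0 \<longleftrightarrow> (\<exists>c>0. \<forall>x y. adj x y \<longrightarrow> weight x y / mu x \<ge> c)"

definition VD :: bool where
  "VD \<longleftrightarrow> (\<exists>D>0. \<forall>x. \<forall>R>0. V x (2 * R) \<le> D * V x R)"

definition TC :: bool where
  "TC \<longleftrightarrow> (\<exists>C>1. \<forall>x. \<forall>R>0. \<forall>y\<in>gball x R. E x (2 * R) / E y R \<le> ennreal C)"

definition vclosure :: "'a set \<Rightarrow> 'a set" where
  "vclosure A = A \<union> {y. \<exists>x\<in>A. adj x y}"

text \<open>
  A function on \<open>vclosure A\<close> is represented by a total function; its values elsewhere are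
  irrelevant because \<open>trans_prob x y = 0\<close> for \<open>x \<in> A\<close> and \<open>y \<notin> vclosure A\<close>.
\<close>

definition harmonic_on :: "('a \<Rightarrow> real) \<Rightarrow> 'a set \<Rightarrow> bool" where
  "harmonic_on h A \<longleftrightarrow> (\<forall>x\<in>A. (\<Sum>\<^sub>\<infinity>y. trans_prob x y * h y) = h x)"

definition MV :: bool where
  "MV \<longleftrightarrow> (\<exists>C>0. \<forall>x. \<forall>R>0. \<forall>u.
     harmonic_on u (gball x R) \<and> (\<forall>y\<in>vclosure (gball x R). u y \<ge> 0) \<longrightarrow>
     u x \<le> C / V x R * (\<Sum>\<^sub>\<infinity>y\<in>gball x R. u y * mu y))"

definition DUE :: bool where
  "DUE \<longleftrightarrow> (\<exists>C>0. \<forall>x. \<forall>n>0. p n x x \<le> C / V x (real (e x n)))"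

definition UE :: bool where
  "UE \<longleftrightarrow> (\<exists>C>0. \<exists>\<beta>>1. \<exists>c>0. \<forall>x y. \<forall>n>0.
     p n x y \<le> C / V x (real (e x n)) *
       exp (- c * (enn2real (E x (real (gdist x y))) / real n) powr (1 / (\<beta> - 1))))"

lemma trans_prob_nonneg: "trans_prob x y \<ge> 0"
  unfolding trans_prob_def mu_def
  by (auto intro!: divide_nonneg_nonneg infsum_nonneg less_imp_le[OF weight_pos])

lemma mu_pos: "mu x > 0"
proof -
  obtain z where z: "z \<noteq> x"
    using infinite_vertices by (metis UNIV_eq_I finite.simps insertI1 singletonI)
  obtain y where y: "adj x y"
    using connected[of x z] z by (metis converse_rtranclpE)
  have "weight x y = (\<Sum>\<^sub>\<infinity>z\<in>{y}. weight x z)"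
    by simp
  also have "\<dots> \<le> mu x"
    unfolding mu_def using y weight_pos
    by (intro infsum_mono2 weight_summable) (auto intro: less_imp_le)
  finally show ?thesis
    using weight_pos[OF y] by simp
qed

text \<open>The transition probabilities out of \<open>x\<close> form a probability distribution.\<close>

lemma pmf_trans_prob: "pmf (embed_pmf (trans_prob x)) y = trans_prob x y"
proof (rule pmf_embed_pmf)
  have "((\<lambda>y. weight x y) has_sum mu x) {y. adj x y}"
    unfolding mu_def using weight_summable by (rule has_sum_infsum)
  then have "((\<lambda>y. weight x y / mu x) has_sum (mu x / mu x)) {y. adj x y}"
    by (rule has_sum_divide_const)
  then have 1: "((\<lambda>y. trans_prob x y) has_sum 1) UNIV"
    using mu_pos[of x]
    by (subst has_sum_cong_neutral[where T = "{y. adj x y}" and g = "\<lambda>y. weight x y / mu x"])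
       (auto simp: trans_prob_def)
  then have "trans_prob x summable_on UNIV"
    by (rule has_sum_imp_summable)
  then have 2: "(\<lambda>y. norm (trans_prob x y)) summable_on UNIV"
    by (simp add: trans_prob_nonneg)
  then have 3: "Infinite_Set_Sum.abs_summable_on (trans_prob x) UNIV"
    by (rule abs_summable_equivalent[THEN iffD1])
  have "(\<integral>\<^sup>+y. ennreal (trans_prob x y) \<partial>count_space UNIV) =
      ennreal (infsetsum (trans_prob x) UNIV)"
    using 3 trans_prob_nonneg by (rule nn_integral_conv_infsetsum)
  also have "infsetsum (trans_prob x) UNIV = 1"
    using infsetsum_infsum[OF 3] infsumI[OF 1] by simp
  finally show "(\<integral>\<^sup>+y. ennreal (trans_prob x y) \<partial>count_space UNIV) = 1"
    by simp
qed (rule trans_prob_nonneg)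

end

end

theory Submission
  imports Defs
begin

text \<open>
  Write \<open>\<tau>(x,R)\<close> for the mean exit time \<open>E(x,R)\<close> as a real number and
  \<open>\<phi>(x,n) = V(x,e(x,n))\<close>.  Under volume and time comparison both \<open>V\<close> and \<open>\<tau>\<close> are comparable
  at nearby points and grow at most polynomially in \<open>R\<close>, and \<open>\<tau>\<close> grows at least polynomially
  (\<open>tau_growth\<close>).  Hence every change of the
  base point, the radius or the time in \<open>\<phi>\<close> costs a fixed power of a ratio of times
  (\<open>V_le_phi\<close>, \<open>phi_compare\<close>).  All other arguments are potential theory of the walk killed
  outside a finite set; the maximum principle (\<open>max_principle\<close>) and the decomposition
  \<open>first_exit_bound\<close> take the place of stopping times, so that the trajectory space occurs
  only in the identification of \<open>P\<close> and \<open>E\<close> with powers of the killed transition operator.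

  \<^emph>\<open>Mean value inequality to diagonal estimate.\<close>  The function
  \<open>F = \<Sum>n\<le>k<2n. p\<^sub>k(x,\<cdot>)\<close> satisfies \<open>(I - P) F = p\<^sub>n(x,\<cdot>) - p\<^sub>2\<^sub>n(x,\<cdot>)\<close>.  Subtracting from \<open>F\<close>
  the Green potential of this difference in \<open>B(x,s)\<close> leaves a nonnegative harmonic function, whose
  value at \<open>x\<close> is at most about \<open>n / V(x,s)\<close> by the mean value inequality, because the total mass
  of \<open>F\<close> is \<open>n\<close>.  The potential itself is at most \<open>\<tau>(x,s) sup p\<^sub>n(x,\<cdot>)\<close>.  As return probabilities
  at even times decrease, \<open>F(x)\<close> is at least a multiple of \<open>n p\<^sub>2\<^sub>n(x,x)\<close>, and so
  \<open>p\<^sub>2\<^sub>n(x,x) \<le> const / V(x,s) + const (\<tau>(x,s) / n) sup p\<^sub>n(x,\<cdot>)\<close>.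
  If \<open>\<tau>(x,s)\<close> is a small fraction of \<open>n\<close>, the last term is absorbed in an induction on \<open>n\<close>, while
  \<open>V(x,s)\<close> is still comparable to \<open>\<phi>(x,n)\<close>.

  \<^emph>\<open>Diagonal to off-diagonal estimate.\<close>  One minus a small multiple of the mean exit time from
  \<open>B(y,r)\<close> is a function \<open>\<psi>\<close> with \<open>P \<psi> \<le> (1 + b) \<psi>\<close>, \<open>b\<close> of order \<open>1 / \<tau>(y,r)\<close>, that is smaller than its boundary values by a fixed factor at \<open>y\<close>.
  Crossing many layers of width \<open>r\<close> multiplies these factors; the best choice of \<open>r\<close> yields the
  stretched exponential tail of the exit time (\<open>exit_tail\<close>).  A path from \<open>x\<close> to \<open>y\<close> leaves the ball
  of half the distance around \<open>x\<close> in the first half of the time, or its reversal does so around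
  \<open>y\<close> (\<open>p_two_exits\<close>); the position at the exit is still near, and from there the diagonal estimate
  and Cauchy--Schwarz apply.  The polynomial comparison factors are absorbed by the exponential.

  \<^emph>\<open>Upper estimate to mean value inequality.\<close>  Summing the estimate over time bounds the Green
  function of \<open>B(x,R)\<close> at distance comparable to \<open>R\<close> from its pole by a multiple of
  \<open>\<tau>(x,R) / V(x,R)\<close> (\<open>green_le_of_UE\<close>).  On the ball of half the radius, a nonnegative harmonic \<open>u\<close>
  is the Green potential of a nonnegative charge carried by the inner boundary of that ball
  (\<open>reduced_potential\<close>), so \<open>u(x)\<close> is at most \<open>\<tau>(x,R) / V(x,R)\<close> times the total charge.  By
  reversibility the integral of the potential is the charge integrated against the mean exit
  time, which is at least a multiple of \<open>\<tau>(x,R)\<close>; since the potential lies below \<open>u\<close>, the total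
  charge is at most a multiple of \<open>\<Sum>u\<mu> / \<tau>(x,R)\<close>.
\<close>

section \<open>Path laws and exit times of a Markov chain\<close>

primrec path_pmf :: "('a \<Rightarrow> 'a pmf) \<Rightarrow> nat \<Rightarrow> 'a \<Rightarrow> 'a list pmf" where
  "path_pmf K 0 x = return_pmf [x]"
| "path_pmf K (Suc n) x = bind_pmf (K x) (\<lambda>z. map_pmf (Cons x) (path_pmf K n z))"

lemma length_path_pmf: "l \<in> set_pmf (path_pmf K n x) \<Longrightarrow> length l = Suc n"
  by (induction n arbitrary: x l) auto

lemma pmf_path_pmf:
  "length l = Suc n \<Longrightarrow> pmf (path_pmf K n x) l =
     indicator {l ! 0} x * (\<Prod>i<n. pmf (K (l ! i)) (l ! Suc i))"
proof (induction n arbitrary: x l)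
  case 0
  then obtain a where "l = [a]" by (cases l) auto
  then show ?case by (auto simp: indicator_def)
next
  case (Suc n)
  then obtain a l' where l: "l = a # l'" and len: "length l' = Suc n" by (cases l) auto
  have inner: "pmf (map_pmf (Cons x) (path_pmf K n z)) l =
      (indicator {a} x * (\<Prod>i<n. pmf (K (l' ! i)) (l' ! Suc i))) * indicator {l' ! 0} z" for z
  proof (cases "a = x")
    case True
    have "pmf (map_pmf (Cons x) (path_pmf K n z)) (Cons x l') = pmf (path_pmf K n z) l'"
      by (rule pmf_map_inj') (auto simp: inj_def)
    then show ?thesis using True Suc.IH[OF len, of z] by (simp add: l indicator_def)
  next
    case False
    then have "l \<notin> set_pmf (map_pmf (Cons x) (path_pmf K n z))" by (auto simp: l)
    then have "pmf (map_pmf (Cons x) (path_pmf K n z)) l = 0"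
      by (simp only: set_pmf_iff not_not)
    then show ?thesis using False by simp
  qed
  have "pmf (path_pmf K (Suc n) x) l =
      (\<integral>z. (indicator {a} x * (\<Prod>i<n. pmf (K (l' ! i)) (l' ! Suc i))) * indicator {l' ! 0} z \<partial>K x)"
    by (simp add: pmf_bind inner)
  also have "\<dots> = (indicator {a} x * (\<Prod>i<n. pmf (K (l' ! i)) (l' ! Suc i))) * pmf (K x) (l' ! 0)"
    by (simp add: measure_pmf_single)
  also have "\<dots> = indicator {l ! 0} x * (\<Prod>i<Suc n. pmf (K (l ! i)) (l ! Suc i))"
    by (subst prod.lessThan_Suc_shift) (auto simp: l indicator_def)
  finally show ?case .
qed

lemma sets_chain_coordinate: "{\<omega>. \<omega> i \<in> B} \<in> sets (markov_chain K x)"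
proof -
  have "(\<lambda>\<omega>. \<omega> i) \<in> measurable (PiM UNIV (\<lambda>_. count_space UNIV)) (count_space UNIV)"
    by (rule measurable_component_singleton) simp
  then have "(\<lambda>\<omega>. \<omega> i) \<in> measurable (markov_chain K x) (count_space UNIV)"
    by (simp add: measurable_def space_PiM)
  from measurable_sets[OF this, of B] show ?thesis
    by (simp add: vimage_def)
qed

lemma sets_chain_cylinder: "{\<omega>. \<forall>i<n. \<omega> i \<in> B i} \<in> sets (markov_chain K x)"
proof (induction n)
  case 0
  have "{\<omega>. \<forall>i<0. \<omega> i \<in> B i} = space (markov_chain K x)" by simp
  then show ?case using sets.top[of "markov_chain K x"] by (simp only:)
next
  case (Suc n)
  have "{\<omega>. \<forall>i<Suc n. \<omega> i \<in> B i} = {\<omega>. \<forall>i<n. \<omega> i \<in> B i} \<inter> {\<omega>. \<omega> n \<in> B n}"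
    by (auto simp: less_Suc_eq)
  then show ?case
    using sets.Int[OF Suc sets_chain_coordinate[of n "B n" K x]] by (simp only:)
qed

lemma sets_chain_stay: "{\<omega>. \<forall>i\<le>n. \<omega> i \<in> A} \<in> sets (markov_chain K x)"
  using sets_chain_cylinder[of "Suc n" "\<lambda>_. A"] by (simp only: less_Suc_eq_le)

lemma measurable_chain_prefix:
  assumes "countable (UNIV :: 'a set)"
  shows "(\<lambda>\<omega>. map \<omega> [0..<n]) \<in> measurable (markov_chain K (x::'a)) (count_space UNIV)"
proof -
  have "countable (UNIV :: 'a list set)"
    using countable_lists[OF assms] by simp
  moreover have "(\<lambda>\<omega>. map \<omega> [0..<n]) -` {l} \<inter> space (markov_chain K x) \<in> sets (markov_chain K x)" for l
  proof -
    have "map \<omega> [0..<n] = l \<longleftrightarrow> length l = n \<and> (\<forall>i<n. \<omega> i = l ! i)" for \<omega> :: "nat \<Rightarrow> 'a"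
      by (auto simp: list_eq_iff_nth_eq)
    then have "(\<lambda>\<omega>. map \<omega> [0..<n]) -` {l} \<inter> space (markov_chain K x) =
      (if length l = n then {\<omega>. \<forall>i<n. \<omega> i \<in> {l ! i}} else {})"
      by (simp add: vimage_def)
    also have "\<dots> \<in> sets (markov_chain K x)"
      using sets_chain_cylinder[of n "\<lambda>i. {l ! i}" K x] sets.empty_sets[of "markov_chain K x"]
      by (simp only: split: if_split) blast
    finally show ?thesis .
  qed
  ultimately show ?thesis
    by (subst measurable_count_space_eq_countable) blast+
qed

text \<open>A law on lists is discrete, hence determined by its point masses, and these are the
  finite-dimensional distributions.  The point of passing to lists is the recursion of
  \<open>path_pmf\<close> on the first step, which becomes the recursion of the killed transition operator.\<close>

lemma distr_chain_prefix:
  assumes "countable (UNIV :: 'a set)"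
  shows "distr (markov_chain K (x::'a)) (count_space UNIV) (\<lambda>\<omega>. map \<omega> [0..<Suc n]) =
    measure_pmf (path_pmf K n x)"
proof (rule measure_eqI_countable[where A = UNIV])
  show "countable (UNIV :: 'a list set)"
    using countable_lists[OF assms] by simp
  fix l :: "'a list"
  have eq: "emeasure (distr (markov_chain K x) (count_space UNIV) (\<lambda>\<omega>. map \<omega> [0..<Suc n])) {l} =
     emeasure (markov_chain K x) {\<omega>. map \<omega> [0..<Suc n] = l}"
    by (subst emeasure_distr[OF measurable_chain_prefix[OF assms]]) (auto intro!: arg_cong2[where f=emeasure])
  show "emeasure (distr (markov_chain K x) (count_space UNIV) (\<lambda>\<omega>. map \<omega> [0..<Suc n])) {l} =
      emeasure (measure_pmf (path_pmf K n x)) {l}"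
  proof (cases "length l = Suc n")
    case True
    then have "{\<omega>. map \<omega> [0..<Suc n] = l} = {\<omega>. \<forall>i\<le>n. \<omega> i = l ! i}"
      by (auto simp: list_eq_iff_nth_eq simp del: upt_Suc)
    then show ?thesis
      unfolding eq emeasure_pmf_single pmf_path_pmf[OF True]
      by (simp add: markov_chain_fdd ennreal_mult' prod_ennreal prod_nonneg indicator_def)
  next
    case False
    then have "{\<omega>. map \<omega> [0..<Suc n] = l} = {}" by auto
    moreover have "pmf (path_pmf K n x) l = 0"
      using length_path_pmf[of l K n x] False by (auto simp: set_pmf_iff)
    ultimately show ?thesis unfolding eq emeasure_pmf_single by simp
  qed
qed auto

lemma emeasure_chain_prefix:
  assumes "countable (UNIV :: 'a set)"
  shows "emeasure (markov_chain K (x::'a)) {\<omega>. (\<forall>i\<le>n. \<omega> i \<in> A) \<and> \<omega> n \<in> Y} =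
    emeasure (measure_pmf (path_pmf K n x)) {l. set l \<subseteq> A \<and> last l \<in> Y}"
proof -
  have "{\<omega>. (\<forall>i\<le>n. \<omega> i \<in> A) \<and> \<omega> n \<in> Y} =
      (\<lambda>\<omega>. map \<omega> [0..<Suc n]) -` {l. set l \<subseteq> A \<and> last l \<in> Y} \<inter> space (markov_chain K x)"
    by (auto simp: less_Suc_eq_le[symmetric] simp del: upt_Suc) auto
  then have "emeasure (markov_chain K x) {\<omega>. (\<forall>i\<le>n. \<omega> i \<in> A) \<and> \<omega> n \<in> Y} =
      emeasure (distr (markov_chain K x) (count_space UNIV) (\<lambda>\<omega>. map \<omega> [0..<Suc n]))
        {l. set l \<subseteq> A \<and> last l \<in> Y}"
    by (simp only: emeasure_distr[OF measurable_chain_prefix[OF assms]] sets_count_space Pow_UNIV UNIV_I)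
  then show ?thesis
    by (simp only: distr_chain_prefix[OF assms])
qed

lemma emeasure_path_pmf_Suc:
  "emeasure (path_pmf K (Suc n) x) {l. set l \<subseteq> A \<and> last l \<in> Y} =
    (if x \<in> A then \<integral>\<^sup>+z. emeasure (path_pmf K n z) {l. set l \<subseteq> A \<and> last l \<in> Y} \<partial>K x else 0)"
proof -
  have *: "emeasure (map_pmf (Cons x) (path_pmf K n z)) {l. set l \<subseteq> A \<and> last l \<in> Y} =
      (if x \<in> A then emeasure (path_pmf K n z) {l. set l \<subseteq> A \<and> last l \<in> Y} else 0)" for z
  proof -
    have "l \<noteq> []" if "l \<in> set_pmf (path_pmf K n z)" for l
      using length_path_pmf[OF that] by auto
    then have "emeasure (path_pmf K n z) (Cons x -` {l. set l \<subseteq> A \<and> last l \<in> Y}) =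
       emeasure (path_pmf K n z) (if x \<in> A then {l. set l \<subseteq> A \<and> last l \<in> Y} else {})"
      by (intro emeasure_eq_AE) (auto simp: AE_measure_pmf_iff)
    then show ?thesis by simp
  qed
  show ?thesis
    unfolding path_pmf.simps emeasure_bind_pmf * by simp
qed

lemma enat_less_exit_time_iff: "enat n < exit_time A \<omega> \<longleftrightarrow> (\<forall>i\<le>n. \<omega> i \<in> A)"
proof
  assume *: "enat n < exit_time A \<omega>"
  show "\<forall>i\<le>n. \<omega> i \<in> A"
  proof (intro allI impI, rule ccontr)
    fix i assume "i \<le> n" "\<omega> i \<notin> A"
    then have "exit_time A \<omega> \<le> enat i" unfolding exit_time_def by (intro INF_lower) auto
    with * \<open>i \<le> n\<close> show False by (meson enat_ord_simps(1) leD order_trans)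
  qed
next
  assume *: "\<forall>i\<le>n. \<omega> i \<in> A"
  have "enat (Suc n) \<le> exit_time A \<omega>"
    unfolding exit_time_def using * by (intro INF_greatest) (auto simp: not_less_eq_eq[symmetric])
  then show "enat n < exit_time A \<omega>" by (meson enat_ord_simps(2) lessI less_le_trans)
qed

text \<open>After this summation by tails only the probabilities of staying in \<open>A\<close> matter.\<close>

lemma nn_integral_exit_time:
  assumes "countable (UNIV :: 'a set)"
  shows "(\<integral>\<^sup>+\<omega>. ennreal_of_enat (exit_time A \<omega>) \<partial>markov_chain K (x::'a)) =
    (\<Sum>n. emeasure (markov_chain K x) {\<omega>. \<forall>i\<le>n. \<omega> i \<in> A})"
proof -
  have "exit_time A -` {t} \<inter> space (markov_chain K x) \<in> sets (markov_chain K x)" for t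
  proof (cases t)
    case (enat n)
    have "{\<omega>. enat n \<le> exit_time A \<omega>} \<in> sets (markov_chain K x)"
    proof (cases n)
      case 0
      have "{\<omega>. enat n \<le> exit_time A \<omega>} = space (markov_chain K x)"
        unfolding 0 zero_enat_def[symmetric] space_markov_chain by (simp only: zero_le UNIV_def)
      then show ?thesis by (simp only: sets.top)
    next
      case (Suc m)
      show ?thesis
        unfolding Suc Suc_ile_eq enat_less_exit_time_iff by (rule sets_chain_stay)
    qed
    moreover have "{\<omega>. enat n < exit_time A \<omega>} \<in> sets (markov_chain K x)"
      unfolding enat_less_exit_time_iff by (rule sets_chain_stay)
    moreover have "exit_time A -` {t} \<inter> space (markov_chain K x) =
      {\<omega>. enat n \<le> exit_time A \<omega>} - {\<omega>. enat n < exit_time A \<omega>}"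
      unfolding enat space_markov_chain by (intro set_eqI) (simp only: vimage_eq Int_iff UNIV_I simp_thms
        singleton_iff Diff_iff mem_Collect_eq not_less eq_iff conj_commute)
    ultimately show ?thesis by (simp only: sets.Diff)
  next
    case infinity
    have "exit_time A -` {t} \<inter> space (markov_chain K x) = (\<Inter>n. {\<omega>. \<forall>i\<le>n. \<omega> i \<in> A})"
    proof -
      have "exit_time A \<omega> = \<infinity> \<longleftrightarrow> (\<forall>n. enat n < exit_time A \<omega>)" for \<omega>
        by (cases "exit_time A \<omega>") auto
      then show ?thesis
        unfolding infinity space_markov_chain
        by (intro set_eqI) (simp only: vimage_eq Int_iff UNIV_I simp_thms singleton_iff INT_iff
          mem_Collect_eq enat_less_exit_time_iff ball_UNIV)
    qed
    also have "\<dots> \<in> sets (markov_chain K x)"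
      by (rule sets.countable_INT'') (simp_all only: countableI_type sets_chain_stay sets.top[of "markov_chain K x", unfolded space_markov_chain])
    finally show ?thesis .
  qed
  then have "exit_time A \<in> measurable (markov_chain K x) (count_space UNIV)"
    by (subst measurable_count_space_eq2_countable) blast
  from nn_integral_enat_function[OF this] show ?thesis
    by (simp add: enat_less_exit_time_iff)
qed

section \<open>Graph distance and the killed semigroup\<close>

context weighted_graph
begin

lemma gdist_le: "(adj ^^ n) x y \<Longrightarrow> gdist x y \<le> n"
  unfolding gdist_def by (rule Least_le)

lemma relpowp_gdist: "(adj ^^ gdist x y) x y"
proof -
  obtain n where "(adj ^^ n) x y"
    using connected[of x y] by (auto simp: rtranclp_power)
  then show ?thesis unfolding gdist_def by (rule LeastI)
qed

lemma gdist_self [simp]: "gdist x x = 0"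
  using gdist_le[of 0 x x] by simp

lemma gdist_eq_0_iff [simp]: "gdist x y = 0 \<longleftrightarrow> x = y"
  using relpowp_gdist[of x y] by (auto dest: sym)

lemma gdist_triangle: "gdist x z \<le> gdist x y + gdist y z"
  by (rule gdist_le) (auto simp: relpowp_add intro: relpowp_gdist)

lemma relpowp_adj_sym: "(adj ^^ n) x y \<Longrightarrow> (adj ^^ n) y x"
proof (induction n arbitrary: y)
  case (Suc n)
  then obtain z where "(adj ^^ n) x z" "adj z y" by auto
  then show ?case using Suc.IH[of z] adj_sym relpowp_Suc_I2 by metis
qed auto

lemma gdist_sym: "gdist x y = gdist y x"
  by (rule antisym; rule gdist_le, rule relpowp_adj_sym, rule relpowp_gdist)

lemma gdist_adj: "adj x y \<Longrightarrow> gdist x y \<le> 1"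
  by (rule gdist_le) (simp only: relpowp_1)

lemma gdist_adj_le: "adj y z \<Longrightarrow> gdist x z \<le> Suc (gdist x y)"
  using gdist_triangle[of x z y] gdist_adj[of y z] by simp

lemma self_in_gball: "R > 0 \<Longrightarrow> x \<in> gball x R"
  by (simp add: gball_def)

lemma gball_mono: "R \<le> S \<Longrightarrow> gball x R \<subseteq> gball x S"
  by (auto simp: gball_def)

lemma gball_subset: "real (gdist x y) + R \<le> S \<Longrightarrow> gball y R \<subseteq> gball x S"
proof
  fix z assume "real (gdist x y) + R \<le> S" "z \<in> gball y R"
  then show "z \<in> gball x S"
    using gdist_triangle[of x z y] by (simp add: gball_def)
qed

abbreviation nbr :: "'a \<Rightarrow> 'a set" where
  "nbr x \<equiv> {y. adj x y}"

lemma sum_trans_prob_le: "finite F \<Longrightarrow> (\<Sum>y\<in>F. trans_prob x y) \<le> 1"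
  using measure_measure_pmf_finite[of F "embed_pmf (trans_prob x)"] measure_pmf.prob_le_1[of "embed_pmf (trans_prob x)" F]
  by (simp add: pmf_trans_prob)

lemma set_pmf_trans_prob: "set_pmf (embed_pmf (trans_prob x)) = nbr x"
  using weight_pos mu_pos by (auto simp: set_pmf_eq pmf_trans_prob trans_prob_def order_less_imp_not_eq2)

lemma trans_prob_reversible: "mu x * trans_prob x y = mu y * trans_prob y x"
  using mu_pos[of x] mu_pos[of y] adj_sym[of x y] adj_sym[of y x] weight_sym[of x y]
  by (auto simp: trans_prob_def)

lemma trans_prob_pos_iff: "trans_prob x y > 0 \<longleftrightarrow> adj x y"
  using weight_pos mu_pos by (auto simp: trans_prob_def)

definition step :: "('a \<Rightarrow> real) \<Rightarrow> 'a \<Rightarrow> real" where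
  "step f x = (\<Sum>y\<in>nbr x. trans_prob x y * f y)"

text \<open>The mean of \<open>f (X\<^sub>n)\<close> over the event that \<open>X\<^sub>0, \<dots>, X\<^sub>n\<close> all lie in \<open>A\<close>.  The choice of an
  indicator for \<open>f\<close> gives the killed transition probabilities \<open>kill\<close>, and \<open>f = 1\<close> the survival
  probabilities \<open>surv\<close>; for \<open>A = UNIV\<close> nothing is killed.\<close>

primrec killed_op :: "'a set \<Rightarrow> ('a \<Rightarrow> real) \<Rightarrow> nat \<Rightarrow> 'a \<Rightarrow> real" where
  "killed_op A f 0 = (\<lambda>x. if x \<in> A then f x else 0)"
| "killed_op A f (Suc n) = (\<lambda>x. if x \<in> A then step (killed_op A f n) x else 0)"

definition kill :: "'a set \<Rightarrow> nat \<Rightarrow> 'a \<Rightarrow> 'a \<Rightarrow> real" where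
  "kill A n x y = killed_op A (indicator {y}) n x"

definition surv :: "'a set \<Rightarrow> nat \<Rightarrow> 'a \<Rightarrow> real" where
  "surv A n x = killed_op A (\<lambda>_. 1) n x"

lemma step_mono: "(\<And>y. adj x y \<Longrightarrow> f y \<le> g y) \<Longrightarrow> step f x \<le> step g x"
  unfolding step_def by (intro sum_mono mult_left_mono trans_prob_nonneg) auto

lemma step_cong: "(\<And>y. adj x y \<Longrightarrow> f y = g y) \<Longrightarrow> step f x = step g x"
  unfolding step_def by (intro sum.cong) auto

lemma step_nonneg: "(\<And>y. adj x y \<Longrightarrow> 0 \<le> f y) \<Longrightarrow> 0 \<le> step f x"
  unfolding step_def by (intro sum_nonneg mult_nonneg_nonneg trans_prob_nonneg) auto

lemma step_add: "step (\<lambda>y. f y + g y) x = step f x + step g x"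
  by (simp add: step_def distrib_left sum.distrib)

lemma step_diff: "step (\<lambda>y. f y - g y) x = step f x - step g x"
  by (simp add: step_def right_diff_distrib sum_subtractf)

lemma step_cmult: "step (\<lambda>y. c * f y) x = c * step f x"
  by (simp add: step_def sum_distrib_left mult.left_commute)

lemma step_sum: "step (\<lambda>y. \<Sum>i\<in>I. f i y) x = (\<Sum>i\<in>I. step (f i) x)"
  unfolding step_def by (simp add: sum_distrib_left) (rule sum.swap)

lemma killed_op_outside: "x \<notin> A \<Longrightarrow> killed_op A f n x = 0"
  by (cases n) auto

lemma killed_op_mono: "(\<And>y. f y \<le> g y) \<Longrightarrow> killed_op A f n x \<le> killed_op A g n x"
  by (induction n arbitrary: x) (auto intro!: step_mono)

lemma killed_op_nonneg: "(\<And>y. 0 \<le> f y) \<Longrightarrow> 0 \<le> killed_op A f n x"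
  by (induction n arbitrary: x) (auto intro!: step_nonneg)

lemma killed_op_mono_set:
  assumes "A \<subseteq> B" "\<And>y. 0 \<le> f y"
  shows "killed_op A f n x \<le> killed_op B f n x"
  using assms(1)
  by (induction n arbitrary: x) (auto intro!: step_mono step_nonneg killed_op_nonneg assms(2))

lemma killed_op_killed_op: "killed_op A (killed_op A f n) m x = killed_op A f (m + n) x"
proof (induction m arbitrary: x)
  case 0 then show ?case by (simp add: killed_op_outside)
next
  case (Suc m) then show ?case by (auto intro!: step_cong)
qed

lemma kill_nonneg: "0 \<le> kill A n x y"
  unfolding kill_def by (rule killed_op_nonneg) simp

lemma kill_outside: "x \<notin> A \<Longrightarrow> kill A n x y = 0"
  unfolding kill_def by (rule killed_op_outside)

lemma kill_0: "kill A 0 x y = (if x = y \<and> x \<in> A then 1 else 0)"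
  by (auto simp: kill_def indicator_def)

lemma kill_Suc: "kill A (Suc n) x y = (if x \<in> A then step (\<lambda>z. kill A n z y) x else 0)"
  by (simp add: kill_def)

lemma kill_mono_set: "A \<subseteq> B \<Longrightarrow> kill A n x y \<le> kill B n x y"
  unfolding kill_def by (rule killed_op_mono_set) auto

lemma surv_nonneg: "0 \<le> surv A n x"
  unfolding surv_def by (rule killed_op_nonneg) simp

lemma surv_outside: "x \<notin> A \<Longrightarrow> surv A n x = 0"
  unfolding surv_def by (rule killed_op_outside)

lemma surv_0: "surv A 0 x = (if x \<in> A then 1 else 0)"
  by (simp add: surv_def)

lemma surv_Suc: "surv A (Suc n) x = (if x \<in> A then step (surv A n) x else 0)"
  by (simp add: surv_def[abs_def])

lemma surv_mono_set: "A \<subseteq> B \<Longrightarrow> surv A n x \<le> surv B n x"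
  unfolding surv_def by (rule killed_op_mono_set) auto

lemma kill_outside_right: "y \<notin> A \<Longrightarrow> kill A n x y = 0"
proof (induction n arbitrary: x)
  case 0 then show ?case by (auto simp: kill_0)
next
  case (Suc n) then show ?case by (simp add: kill_Suc step_def)
qed

lemma kill_eq_0_far: "n < gdist x y \<Longrightarrow> kill A n x y = 0"
proof (induction n arbitrary: x)
  case 0 then show ?case by (auto simp: kill_0)
next
  case (Suc n)
  have "kill A n z y = 0" if "adj x z" for z
  proof (rule Suc.IH)
    show "n < gdist z y"
      using Suc.prems gdist_adj_le[OF adj_sym[OF that], of y] by (simp add: gdist_sym)
  qed
  then show ?case by (simp add: kill_Suc step_def)
qed

end

locale uniform_graph = weighted_graph +
  fixes c0 :: real
  assumes c0_pos: "c0 > 0"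
    and c0_le: "adj x y \<Longrightarrow> c0 \<le> weight x y / mu x"
begin

lemma c0_le_trans_prob: "adj x y \<Longrightarrow> c0 \<le> trans_prob x y"
  using c0_le by (simp add: trans_prob_def)

text \<open>The transition probabilities out of a vertex add up to at most one and none is below \<open>c0\<close>.\<close>

lemma finite_nbr [simp, intro]: "finite (nbr x)"
proof (rule ccontr)
  assume "infinite (nbr x)"
  then obtain F where F: "finite F" "card F = Suc (nat \<lceil>1 / c0\<rceil>)" "F \<subseteq> nbr x"
    using infinite_arbitrarily_large by blast
  have "real (card F) * c0 \<le> (\<Sum>y\<in>F. trans_prob x y)"
    using F by (intro sum_bounded_below) (auto intro: c0_le_trans_prob)
  also have "\<dots> \<le> 1" by (rule sum_trans_prob_le[OF F(1)])
  finally have "real (card F) \<le> 1 / c0" using c0_pos by (simp add: field_simps)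
  then show False using F(2) by (simp add: of_nat_nat) linarith
qed

lemma sum_trans_prob: "(\<Sum>y\<in>nbr x. trans_prob x y) = 1"
  using sum_pmf_eq_1[OF finite_nbr, of "embed_pmf (trans_prob x)" x]
  by (simp add: pmf_trans_prob set_pmf_trans_prob)

lemma step_const: "step (\<lambda>_. c) x = c"
  by (simp add: step_def sum_trans_prob flip: sum_distrib_right)

lemma step_le_const: "(\<And>y. adj x y \<Longrightarrow> f y \<le> c) \<Longrightarrow> step f x \<le> c"
  using step_mono[of x f "\<lambda>_. c"] by (simp add: step_const)

lemma step_alt: "finite S \<Longrightarrow> nbr x \<subseteq> S \<Longrightarrow> step f x = (\<Sum>y\<in>S. trans_prob x y * f y)"
  unfolding step_def by (rule sum.mono_neutral_left) (auto simp: trans_prob_def)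

lemma infsum_trans_prob: "(\<Sum>\<^sub>\<infinity>y. trans_prob x y * f y) = step f x"
proof -
  have "(\<Sum>\<^sub>\<infinity>y. trans_prob x y * f y) = (\<Sum>\<^sub>\<infinity>y\<in>nbr x. trans_prob x y * f y)"
    by (rule infsum_cong_neutral) (auto simp: trans_prob_def)
  then show ?thesis by (simp add: step_def)
qed

lemma harmonic_on_iff: "harmonic_on h A \<longleftrightarrow> (\<forall>x\<in>A. step h x = h x)"
  by (simp add: harmonic_on_def infsum_trans_prob)

lemma finite_relpowp: "finite {y. (adj ^^ n) x y}"
proof (induction n)
  case (Suc n)
  have "{y. (adj ^^ Suc n) x y} = (\<Union>z\<in>{y. (adj ^^ n) x y}. nbr z)" by auto
  then show ?case using Suc by simp
qed simp

lemma finite_gball [simp, intro]: "finite (gball x R)"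
proof -
  have "gball x R \<subseteq> (\<Union>n\<le>nat \<lceil>R\<rceil>. {y. (adj ^^ n) x y})"
  proof
    fix y assume "y \<in> gball x R"
    then have "gdist x y \<le> nat \<lceil>R\<rceil>" unfolding gball_def by simp linarith
    then show "y \<in> (\<Union>n\<le>nat \<lceil>R\<rceil>. {y. (adj ^^ n) x y})" using relpowp_gdist[of x y] by auto
  qed
  then show ?thesis by (rule finite_subset) (auto intro: finite_relpowp)
qed

lemma finite_gdist_le [simp, intro]: "finite {y. gdist x y \<le> n}"
  by (rule finite_subset[OF _ finite_gball[of x "real n + 1"]]) (auto simp: gball_def)

lemma ex_other_neighbour: "\<exists>y. adj x y \<and> y \<noteq> x"
proof (rule ccontr)
  assume *: "\<not> (\<exists>y. adj x y \<and> y \<noteq> x)"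
  have "z = x" for z
    using connected[of x z] by induction (use * in auto)
  then have "(UNIV :: 'a set) \<subseteq> {x}" by blast
  then show False using infinite_vertices finite_subset by blast
qed

text \<open>The set \<open>S\<close> is a parameter so that the same lemma serves finite \<open>A\<close>, where \<open>S = A\<close>, and
  \<open>A = UNIV\<close>, where \<open>S\<close> is a large ball.\<close>

lemma killed_op_kernel:
  assumes "finite S" "\<And>y. y \<notin> S \<Longrightarrow> kill A n x y = 0"
  shows "killed_op A f n x = (\<Sum>y\<in>S. kill A n x y * f y)"
  using assms(2)
proof (induction n arbitrary: x)
  case 0
  show ?case
  proof (cases "x \<in> A")
    case True
    then have "x \<in> S" using 0[of x] by (auto simp: kill_0)
    then show ?thesis using True assms(1) by (simp add: kill_0 if_distrib[of "\<lambda>c. c * _"] cong: if_cong)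
  qed (simp add: kill_0)
next
  case (Suc n)
  show ?case
  proof (cases "x \<in> A")
    case True
    have "kill A n z y = 0" if "adj x z" "y \<notin> S" for y z
    proof -
      have "(\<Sum>w\<in>nbr x. trans_prob x w * kill A n w y) = 0"
        using Suc.prems[OF that(2)] True by (simp add: kill_Suc step_def)
      then have "trans_prob x z * kill A n z y = 0"
        using that(1) by (subst (asm) sum_nonneg_eq_0_iff) (auto intro: mult_nonneg_nonneg trans_prob_nonneg kill_nonneg)
      then show ?thesis using that(1) trans_prob_pos_iff[of x z] by simp
    qed
    then have "step (killed_op A f n) x = step (\<lambda>z. \<Sum>y\<in>S. kill A n z y * f y) x"
      using Suc.IH by (intro step_cong) blast
    also have "\<dots> = (\<Sum>y\<in>S. step (\<lambda>z. kill A n z y) x * f y)"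
      by (subst step_sum) (simp add: step_cmult mult.commute[of _ "f _"])
    finally show ?thesis using True by (simp add: kill_Suc)
  qed (simp add: kill_Suc)
qed

lemma kill_support_finite: "finite A \<Longrightarrow> y \<notin> A \<Longrightarrow> kill A n x y = 0"
  by (rule kill_outside_right)

lemma kill_add:
  assumes "finite S" "\<And>z. z \<notin> S \<Longrightarrow> kill A m x z = 0"
  shows "kill A (m + n) x y = (\<Sum>z\<in>S. kill A m x z * kill A n z y)"
  using killed_op_kernel[OF assms, of "killed_op A (indicator {y}) n"]
  by (simp add: killed_op_killed_op kill_def)

lemma surv_eq_sum:
  assumes "finite S" "\<And>z. z \<notin> S \<Longrightarrow> kill A n x z = 0"
  shows "surv A n x = (\<Sum>z\<in>S. kill A n x z)"
  using killed_op_kernel[OF assms, of "\<lambda>_. 1"] by (simp add: surv_def)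

text \<open>Reversibility passes to several steps by splitting off the first step on one side and the
  last step on the other.  Killing is symmetric because it does not distinguish the two ends.\<close>

lemma kill_sym: "mu x * kill A n x y = mu y * kill A n y x"
proof (induction n arbitrary: x y)
  case 0 then show ?case by (auto simp: kill_0)
next
  case (Suc n)
  have one: "mu x * kill A 1 x z = mu z * kill A 1 z x" for x z
  proof -
    have "kill A 1 x z = (if x \<in> A \<and> z \<in> A then trans_prob x z else 0)" for x z
    proof -
      have "(\<Sum>y\<in>nbr x. trans_prob x y * (if y = z \<and> y \<in> A then 1 else 0)) =
          (\<Sum>y\<in>nbr x. if y = z then (if z \<in> A then trans_prob x z else 0) else 0)"
        by (rule sum.cong) auto
      also have "\<dots> = (if z \<in> A then trans_prob x z else 0)"
        by (auto simp: trans_prob_def)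
      finally show ?thesis by (simp add: kill_Suc kill_0 step_def)
    qed
    then show ?thesis using trans_prob_reversible[of x z] by simp
  qed
  define S where "S = {z. gdist x z \<le> 1} \<union> {z. gdist y z \<le> n}"
  have S: "finite S" by (simp add: S_def)
  have "mu x * kill A (1 + n) x y = (\<Sum>z\<in>S. mu x * kill A 1 x z * kill A n z y)"
    by (subst kill_add[OF S]) (auto simp: S_def sum_distrib_left mult.assoc intro!: kill_eq_0_far)
  also have "\<dots> = (\<Sum>z\<in>S. mu y * (kill A n y z * kill A 1 z x))"
  proof (rule sum.cong)
    fix z
    have "mu x * kill A 1 x z * kill A n z y = kill A 1 z x * (mu z * kill A n z y)"
      by (simp only: one[of x z] mult_ac)
    also have "\<dots> = mu y * (kill A n y z * kill A 1 z x)"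
      by (simp only: Suc.IH[of z y] mult_ac)
    finally show "mu x * kill A 1 x z * kill A n z y = mu y * (kill A n y z * kill A 1 z x)" .
  qed simp
  also have "\<dots> = mu y * kill A (n + 1) y x"
    by (subst kill_add[OF S, of A n y 1]) (auto simp: S_def sum_distrib_left intro!: kill_eq_0_far)
  finally show ?case by simp
qed

lemma surv_le_1: "surv A n x \<le> 1"
proof (induction n arbitrary: x)
  case (Suc n) then show ?case by (auto simp: surv_Suc intro!: step_le_const)
qed (simp add: surv_0)

lemma surv_Suc_le: "surv A (Suc n) x \<le> surv A n x"
proof (induction n arbitrary: x)
  case 0 then show ?case using surv_le_1 by (auto simp: surv_Suc surv_0 intro!: step_le_const)
next
  case (Suc n)
  have "step (surv A (Suc n)) x \<le> step (surv A n) x" by (rule step_mono) (rule Suc.IH)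
  then show ?case by (subst (1 2) surv_Suc) simp
qed

lemma surv_antimono: "m \<le> n \<Longrightarrow> surv A n x \<le> surv A m x"
  using decseq_SucI[of "\<lambda>n. surv A n x", OF surv_Suc_le] by (simp add: decseq_def)

lemma surv_UNIV: "surv UNIV n x = 1"
  by (induction n arbitrary: x) (auto simp: surv_0 surv_Suc step_const cong: step_cong)

lemma kill_le_surv: "kill A n x y \<le> surv A n x"
  unfolding kill_def surv_def by (rule killed_op_mono) (auto simp: indicator_def)

lemma kill_le_1: "kill A n x y \<le> 1"
  using kill_le_surv surv_le_1 order_trans by blast

section \<open>Transition probabilities and mean exit times through the semigroup\<close>

lemma emeasure_path_eq_killed_op:
  "emeasure (path_pmf (\<lambda>z. embed_pmf (trans_prob z)) n x) {l. set l \<subseteq> A \<and> last l \<in> Y} =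
    ennreal (killed_op A (indicator Y) n x)"
proof (induction n arbitrary: x)
  case 0
  show ?case by (simp add: indicator_def)
next
  case (Suc n)
  have "(\<integral>\<^sup>+z. ennreal (killed_op A (indicator Y) n z) \<partial>embed_pmf (trans_prob x)) =
      (\<Sum>z\<in>nbr x. ennreal (killed_op A (indicator Y) n z) * ennreal (trans_prob x z))"
    by (subst nn_integral_measure_pmf_support[of "nbr x"]) (auto simp: set_pmf_trans_prob pmf_trans_prob)
  also have "\<dots> = ennreal (step (killed_op A (indicator Y) n) x)"
    unfolding step_def
    by (subst sum_ennreal[symmetric])
       (auto simp: ennreal_mult' trans_prob_nonneg mult.commute intro!: mult_nonneg_nonneg killed_op_nonneg)
  finally show ?case unfolding emeasure_path_pmf_Suc Suc.IH by simp
qed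

lemma P_eq_kill: "P n x y = kill UNIV n x y"
proof -
  have "emeasure (walk x) {\<omega>. \<omega> n = y} = ennreal (kill UNIV n x y)"
    using emeasure_chain_prefix[OF countable_vertices, of "\<lambda>z. embed_pmf (trans_prob z)" x n UNIV "{y}"]
    by (simp add: walk_def emeasure_path_eq_killed_op[of n x UNIV "{y}", simplified] kill_def)
  then show ?thesis
    by (simp add: P_def measure_def walk_def kill_nonneg)
qed

lemma emeasure_stay: "emeasure (walk x) {\<omega>. \<forall>i\<le>n. \<omega> i \<in> A} = ennreal (surv A n x)"
  using emeasure_chain_prefix[OF countable_vertices, of "\<lambda>z. embed_pmf (trans_prob z)" x n A UNIV]
    emeasure_path_eq_killed_op[of n x A UNIV]
  by (simp add: walk_def surv_def indicator_def)

lemma E_eq_suminf: "E x R = (\<Sum>n. ennreal (surv (gball x R) n x))"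
  unfolding E_def walk_def nn_integral_exit_time[OF countable_vertices] emeasure_stay[unfolded walk_def] ..

end

section \<open>Green functions and the maximum principle\<close>

context uniform_graph
begin

text \<open>The sets with a summable Green function: the walk leaves them in finite mean time.\<close>

definition transient :: "'a set \<Rightarrow> bool" where
  "transient A \<longleftrightarrow> finite A \<and> (\<forall>x. summable (\<lambda>n. surv A n x))"

definition mean_exit :: "'a set \<Rightarrow> 'a \<Rightarrow> real" where
  "mean_exit A x = (\<Sum>n. surv A n x)"

definition green :: "'a set \<Rightarrow> 'a \<Rightarrow> 'a \<Rightarrow> real" where
  "green A x y = (\<Sum>n. kill A n x y)"

definition green_op :: "'a set \<Rightarrow> ('a \<Rightarrow> real) \<Rightarrow> 'a \<Rightarrow> real" where
  "green_op A f x = (\<Sum>y\<in>A. green A x y * f y)"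

lemma transient_finite: "transient A \<Longrightarrow> finite A"
  by (simp add: transient_def)

lemma transient_summable: "transient A \<Longrightarrow> summable (\<lambda>n. surv A n x)"
  by (simp add: transient_def)

lemma transient_summable_kill: "transient A \<Longrightarrow> summable (\<lambda>n. kill A n x y)"
  by (rule summable_comparison_test'[of "\<lambda>n. surv A n x" 0])
    (auto simp: kill_nonneg kill_le_surv transient_summable)

lemma transient_subset: "transient B \<Longrightarrow> A \<subseteq> B \<Longrightarrow> transient A"
  unfolding transient_def
proof (intro conjI allI)
  fix x assume *: "finite B \<and> (\<forall>x. summable (\<lambda>n. surv B n x))" "A \<subseteq> B"
  then show "finite A" using finite_subset by blast
  show "summable (\<lambda>n. surv A n x)"
    by (rule summable_comparison_test'[of "\<lambda>n. surv B n x" 0]) (use * in \<open>auto simp: surv_nonneg surv_mono_set\<close>)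
qed

text \<open>Iterating the inequality \<open>step f \<le> f\<close> along the killed walk gives \<open>f \<ge> - M * surv A n\<close> with
  \<open>M\<close> a bound for \<open>\<bar>f\<bar>\<close> on \<open>A\<close>, and survival probabilities tend to zero.\<close>

lemma max_principle:
  assumes A: "transient A"
    and super: "\<And>x. x \<in> A \<Longrightarrow> step f x \<le> f x"
    and bdry: "\<And>y. y \<in> vclosure A \<Longrightarrow> y \<notin> A \<Longrightarrow> 0 \<le> f y"
    and x: "x \<in> A"
  shows "0 \<le> f x"
proof -
  define M where "M = (\<Sum>y\<in>A. \<bar>f y\<bar>)"
  have M: "- M \<le> f y" if "y \<in> A" for y
    using member_le_sum[of y A "\<lambda>y. \<bar>f y\<bar>"] that transient_finite[OF A] by (simp add: M_def)
  have "- (M * surv A n z) \<le> f z" if "z \<in> A" for n z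
    using that
  proof (induction n arbitrary: z)
    case 0 then show ?case using M by (simp add: surv_0)
  next
    case (Suc n)
    have "- (M * surv A (Suc n) z) = step (\<lambda>w. - M * surv A n w) z"
      using Suc.prems by (simp add: surv_Suc step_cmult[of "- M", simplified])
    also have "\<dots> \<le> step f z"
    proof (rule step_mono)
      fix w assume "adj z w"
      show "- M * surv A n w \<le> f w"
      proof (cases "w \<in> A")
        case True then show ?thesis using Suc.IH by simp
      next
        case False
        then have "0 \<le> f w" using bdry[of w] Suc.prems \<open>adj z w\<close> by (auto simp: vclosure_def)
        then show ?thesis using False by (simp add: surv_outside)
      qed
    qed
    also have "\<dots> \<le> f z" by (rule super[OF Suc.prems])
    finally show ?case .
  qed
  moreover have "(\<lambda>n. - (M * surv A n x)) \<longlonglongrightarrow> - (M * 0)"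
    by (intro tendsto_intros summable_LIMSEQ_zero transient_summable A)
  ultimately show ?thesis using x by (intro LIMSEQ_le_const2[where X = "\<lambda>n. - (M * surv A n x)"]) auto
qed

lemma mean_exit_nonneg: "transient A \<Longrightarrow> 0 \<le> mean_exit A x"
  unfolding mean_exit_def by (intro suminf_nonneg transient_summable surv_nonneg)

lemma mean_exit_outside: "x \<notin> A \<Longrightarrow> mean_exit A x = 0"
  by (simp add: mean_exit_def surv_outside)

lemma step_suminf:
  assumes "\<And>y. summable (\<lambda>n. F n y)"
  shows "step (\<lambda>y. \<Sum>n. F n y) x = (\<Sum>n. step (F n) x)"
  unfolding step_def
  by (subst suminf_sum) (auto intro!: sum.cong summable_mult assms simp: suminf_mult assms)

lemma mean_exit_step:
  assumes A: "transient A" and x: "x \<in> A"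
  shows "step (mean_exit A) x = mean_exit A x - 1"
proof -
  have "mean_exit A x = surv A 0 x + (\<Sum>n. surv A (Suc n) x)"
    unfolding mean_exit_def using suminf_split_head[OF transient_summable[OF A, of x]] by simp
  also have "(\<Sum>n. surv A (Suc n) x) = step (mean_exit A) x"
    unfolding mean_exit_def using x by (simp add: surv_Suc step_suminf[OF transient_summable[OF A]])
  finally show ?thesis using x by (simp add: surv_0)
qed

lemma green_nonneg: "transient A \<Longrightarrow> 0 \<le> green A x y"
  unfolding green_def by (intro suminf_nonneg transient_summable_kill kill_nonneg)

lemma green_outside: "x \<notin> A \<Longrightarrow> green A x y = 0"
  by (simp add: green_def kill_outside)

lemma green_step:
  assumes A: "transient A" and x: "x \<in> A"
  shows "step (\<lambda>z. green A z y) x = green A x y - (if x = y then 1 else 0)"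
proof -
  have "green A x y = kill A 0 x y + (\<Sum>n. kill A (Suc n) x y)"
    unfolding green_def using suminf_split_head[OF transient_summable_kill[OF A, of x y]] by simp
  also have "(\<Sum>n. kill A (Suc n) x y) = step (\<lambda>z. green A z y) x"
    unfolding green_def using x by (simp add: kill_Suc step_suminf[OF transient_summable_kill[OF A]])
  finally show ?thesis using x by (simp add: kill_0)
qed

lemma green_sym: "transient A \<Longrightarrow> mu x * green A x y = mu y * green A y x"
  unfolding green_def by (simp add: suminf_mult[symmetric] transient_summable_kill kill_sym[of x A _ y])

lemma green_op_outside: "x \<notin> A \<Longrightarrow> green_op A f x = 0"
  by (simp add: green_op_def green_outside)

lemma green_op_step:
  assumes A: "transient A" and x: "x \<in> A"
  shows "step (green_op A f) x = green_op A f x - f x"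
proof -
  have "step (green_op A f) x = (\<Sum>y\<in>A. f y * step (\<lambda>z. green A z y) x)"
    unfolding green_op_def[abs_def] by (simp add: step_sum step_cmult[symmetric] mult.commute)
  also have "\<dots> = green_op A f x - f x"
    using x transient_finite[OF A]
    by (simp add: green_step[OF A x] green_op_def right_diff_distrib sum_subtractf mult.commute
        if_distrib[of "\<lambda>c. _ * c"] cong: if_cong)
  finally show ?thesis .
qed

lemma green_op_mono: "transient A \<Longrightarrow> (\<And>y. y \<in> A \<Longrightarrow> f y \<le> g y) \<Longrightarrow> green_op A f x \<le> green_op A g x"
  unfolding green_op_def by (intro sum_mono mult_left_mono green_nonneg)

lemma green_op_nonneg: "transient A \<Longrightarrow> (\<And>y. y \<in> A \<Longrightarrow> 0 \<le> f y) \<Longrightarrow> 0 \<le> green_op A f x"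
  unfolding green_op_def by (intro sum_nonneg mult_nonneg_nonneg green_nonneg)

lemma green_op_diff: "green_op A (\<lambda>y. f y - g y) x = green_op A f x - green_op A g x"
  by (simp add: green_op_def right_diff_distrib sum_subtractf)

lemma green_op_const:
  assumes A: "transient A"
  shows "green_op A (\<lambda>_. c) x = c * mean_exit A x"
proof -
  have "(\<Sum>y\<in>A. green A x y) = (\<Sum>n. \<Sum>y\<in>A. kill A n x y)"
    unfolding green_def by (rule suminf_sum[symmetric]) (rule transient_summable_kill[OF A])
  also have "\<dots> = mean_exit A x"
    unfolding mean_exit_def using transient_finite[OF A]
    by (subst surv_eq_sum[of A]) (auto simp: kill_support_finite)
  finally show ?thesis by (simp add: green_op_def sum_distrib_right[symmetric])
qed

lemma green_op_le_mean_exit: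
  assumes A: "transient A" and "\<And>y. y \<in> A \<Longrightarrow> f y \<le> c"
  shows "green_op A f x \<le> c * mean_exit A x"
  using green_op_mono[of A f "\<lambda>_. c" x] assms by (simp add: green_op_const[OF A])

text \<open>The difference of both sides is harmonic in \<open>A\<close> and vanishes on the boundary.\<close>

lemma green_op_unique:
  assumes A: "transient A" and bdry: "\<And>y. y \<in> vclosure A \<Longrightarrow> y \<notin> A \<Longrightarrow> f y = 0"
    and x: "x \<in> A"
  shows "f x = green_op A (\<lambda>z. f z - step f z) x"
proof -
  let ?g = "\<lambda>z. f z - step f z"
  have "0 \<le> f x - green_op A ?g x"
    by (rule max_principle[OF A _ _ x]) (auto simp: step_diff green_op_step[OF A] bdry green_op_outside)
  moreover have "0 \<le> green_op A ?g x - f x"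
    by (rule max_principle[OF A _ _ x]) (auto simp: step_diff green_op_step[OF A] bdry green_op_outside)
  ultimately show ?thesis by simp
qed

text \<open>Integrating the symmetric Green kernel over its first argument gives the mean exit time
  in the second one.\<close>

lemma sum_mu_green_op:
  assumes A: "transient A"
  shows "(\<Sum>y\<in>A. mu y * green_op A f y) = (\<Sum>z\<in>A. mu z * f z * mean_exit A z)"
proof -
  have "(\<Sum>y\<in>A. mu y * green_op A f y) = (\<Sum>y\<in>A. \<Sum>z\<in>A. f z * (mu y * green A y z))"
    by (simp add: green_op_def sum_distrib_left mult_ac)
  also have "\<dots> = (\<Sum>y\<in>A. \<Sum>z\<in>A. f z * (mu z * green A z y))"
    by (simp add: green_sym[OF A])
  also have "\<dots> = (\<Sum>z\<in>A. \<Sum>y\<in>A. f z * (mu z * green A z y))" by (rule sum.swap)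
  also have "\<dots> = (\<Sum>z\<in>A. mu z * f z * green_op A (\<lambda>_. 1) z)"
    by (simp add: green_op_def sum_distrib_left mult_ac)
  finally show ?thesis by (simp add: green_op_const[OF A])
qed

lemma mean_exit_mono_set: "transient B \<Longrightarrow> A \<subseteq> B \<Longrightarrow> mean_exit A x \<le> mean_exit B x"
  unfolding mean_exit_def
  by (intro suminf_le surv_mono_set transient_summable) (auto intro: transient_subset)

lemma mean_exit_ge_sum: "transient A \<Longrightarrow> (\<Sum>k<n. surv A k x) \<le> mean_exit A x"
  unfolding mean_exit_def by (intro sum_le_suminf transient_summable) (auto simp: surv_nonneg)

section \<open>Heat kernel: symmetry, Cauchy--Schwarz, monotonicity, first exit\<close>

lemma p_eq: "p n x y = kill UNIV n x y / mu y"
  by (simp add: p_def P_eq_kill)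

lemma kill_UNIV_eq: "kill UNIV n x y = p n x y * mu y"
  using mu_pos[of y] by (simp add: p_eq)

lemma p_nonneg: "0 \<le> p n x y"
  using mu_pos[of y] by (simp add: p_eq kill_nonneg)

lemma p_sym: "p n x y = p n y x"
  using kill_sym[of x UNIV n y] mu_pos[of x] mu_pos[of y] by (simp add: p_eq field_simps)

lemma p_eq_0_far: "n < gdist x y \<Longrightarrow> p n x y = 0"
  by (simp add: p_eq kill_eq_0_far)

lemma p_0: "p 0 x y = (if x = y then 1 / mu x else 0)"
  by (simp add: p_eq kill_0)

lemma p_le: "p n x x \<le> 1 / mu x"
  using kill_le_1[of UNIV n x x] mu_pos[of x] by (simp add: p_eq divide_right_mono)

lemma step_p: "step (p n x) y = p (Suc n) x y"
proof -
  have *: "p n x z = 1 / mu x * kill UNIV n z x" for n z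
    by (subst p_sym) (simp add: p_eq)
  have "step (p n x) y = step (\<lambda>z. 1 / mu x * kill UNIV n z x) y"
    by (rule step_cong) (rule *)
  also have "\<dots> = p (Suc n) x y"
    by (simp only: step_cmult * kill_Suc UNIV_I if_True)
  finally show ?thesis .
qed

lemma sum_p_le_1: "finite S \<Longrightarrow> (\<Sum>y\<in>S. p n x y * mu y) \<le> 1"
proof -
  assume S: "finite S"
  let ?T = "S \<union> {y. gdist x y \<le> n}"
  have "(\<Sum>y\<in>S. kill UNIV n x y) \<le> (\<Sum>y\<in>?T. kill UNIV n x y)"
    using S by (intro sum_mono2) (auto simp: kill_nonneg)
  also have "\<dots> = surv UNIV n x"
    using S by (intro surv_eq_sum[symmetric]) (auto simp: kill_eq_0_far)
  finally show ?thesis by (simp add: surv_UNIV kill_UNIV_eq)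
qed

lemma p_add:
  assumes "finite S" "\<And>z. z \<notin> S \<Longrightarrow> p m x z = 0"
  shows "p (m + n) x y = (\<Sum>z\<in>S. p m x z * p n z y * mu z)"
proof -
  have "kill UNIV (m + n) x y = (\<Sum>z\<in>S. kill UNIV m x z * kill UNIV n z y)"
    using assms by (intro kill_add) (auto simp: kill_UNIV_eq)
  also have "\<dots> = (\<Sum>z\<in>S. p m x z * p n z y * mu z) * mu y"
    unfolding kill_UNIV_eq sum_distrib_right by (rule sum.cong) (simp_all only: mult_ac)
  finally show ?thesis using mu_pos[of y] by (simp add: kill_UNIV_eq)
qed

lemma p_diag:
  assumes "finite S" "\<And>z. z \<notin> S \<Longrightarrow> p n x z = 0"
  shows "p (2 * n) x x = (\<Sum>z\<in>S. (p n x z)\<^sup>2 * mu z)"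
proof -
  have "p (2 * n) x x = (\<Sum>z\<in>S. p n x z * p n z x * mu z)"
    unfolding mult_2 by (rule p_add[OF assms])
  also have "\<dots> = (\<Sum>z\<in>S. (p n x z)\<^sup>2 * mu z)"
    unfolding power2_eq_square
  proof (rule sum.cong)
  fix z show "p n x z * p n z x * mu z = p n x z * p n x z * mu z"
      by (simp only: p_sym[of n z x])
  qed simp
  finally show ?thesis .
qed

lemma p_Cauchy_Schwarz: "(p (m + n) x y)\<^sup>2 \<le> p (2 * m) x x * p (2 * n) y y"
proof -
  define S where "S = {z. gdist x z \<le> m} \<union> {z. gdist y z \<le> n}"
  have S: "finite S" by (simp add: S_def)
  have x: "p m x z = 0" and y: "p n y z = 0" if "z \<notin> S" for z
    using that by (auto simp: S_def p_eq_0_far)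
  have eq: "p (m + n) x y = (\<Sum>z\<in>S. (p m x z * sqrt (mu z)) * (p n y z * sqrt (mu z)))"
  proof (subst p_add[OF S x], assumption, rule sum.cong)
    fix z
    have "p m x z * p n z y * mu z = p m x z * p n y z * (sqrt (mu z) * sqrt (mu z))"
      using mu_pos[of z] by (simp add: p_sym[of n z y] less_imp_le)
    then show "p m x z * p n z y * mu z = (p m x z * sqrt (mu z)) * (p n y z * sqrt (mu z))"
      by (simp only: mult_ac)
  qed simp
  have "(p (m + n) x y)\<^sup>2 \<le> (\<Sum>z\<in>S. (p m x z * sqrt (mu z))\<^sup>2) * (\<Sum>z\<in>S. (p n y z * sqrt (mu z))\<^sup>2)"
    unfolding eq by (rule Cauchy_Schwarz_ineq_sum)
  also have "\<dots> = p (2 * m) x x * p (2 * n) y y"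
  proof -
    have "p (2 * m) x x = (\<Sum>z\<in>S. (p m x z)\<^sup>2 * mu z)" by (rule p_diag[of S m x, OF S]) (rule x)
    moreover have "p (2 * n) y y = (\<Sum>z\<in>S. (p n y z)\<^sup>2 * mu z)" by (rule p_diag[of S n y, OF S]) (rule y)
    ultimately show ?thesis by (simp only: power_mult_distrib real_sqrt_pow2[OF less_imp_le[OF mu_pos]])
  qed
  finally show ?thesis .
qed

lemma step_square_le: "(step f x)\<^sup>2 \<le> step (\<lambda>y. (f y)\<^sup>2) x"
proof -
  have "(step f x)\<^sup>2 = (\<Sum>y\<in>nbr x. sqrt (trans_prob x y) * (sqrt (trans_prob x y) * f y))\<^sup>2"
    by (simp add: step_def mult.assoc[symmetric] trans_prob_nonneg)
  also have "\<dots> \<le> (\<Sum>y\<in>nbr x. (sqrt (trans_prob x y))\<^sup>2) * (\<Sum>y\<in>nbr x. (sqrt (trans_prob x y) * f y)\<^sup>2)"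
    by (rule Cauchy_Schwarz_ineq_sum)
  also have "\<dots> = step (\<lambda>y. (f y)\<^sup>2) x"
    by (simp add: trans_prob_nonneg sum_trans_prob step_def power_mult_distrib)
  finally show ?thesis .
qed

text \<open>The averaging operator contracts \<open>L\<^sup>2(\<mu>)\<close>.\<close>

lemma p_diag_Suc_le: "p (2 * Suc n) x x \<le> p (2 * n) x x"
proof -
  define S where "S = {z. gdist x z \<le> Suc n}"
  define T where "T = {z. gdist x z \<le> Suc (Suc n)}"
  have S: "finite S" and T: "finite T" by (simp_all add: S_def T_def)
  have nbrS: "nbr z \<subseteq> T" if "z \<in> S" for z
  proof
    fix w assume "w \<in> nbr z"
    then show "w \<in> T" using that gdist_adj_le[of z w x] by (simp add: S_def T_def)
  qed
  have "p (2 * Suc n) x x = (\<Sum>z\<in>S. (step (p n x) z)\<^sup>2 * mu z)"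
    by (subst p_diag[OF S]) (auto simp: S_def step_p intro!: p_eq_0_far)
  also have "\<dots> \<le> (\<Sum>z\<in>S. step (\<lambda>w. (p n x w)\<^sup>2) z * mu z)"
    using mu_pos by (intro sum_mono mult_right_mono step_square_le) (simp add: less_imp_le)
  also have "\<dots> = (\<Sum>z\<in>S. \<Sum>w\<in>T. (p n x w)\<^sup>2 * (mu z * trans_prob z w))"
    using nbrS by (intro sum.cong) (auto simp: step_alt[OF T] sum_distrib_left mult_ac)
  also have "\<dots> = (\<Sum>w\<in>T. \<Sum>z\<in>S. (p n x w)\<^sup>2 * (mu w * trans_prob w z))"
    by (subst sum.swap) (simp add: trans_prob_reversible)
  also have "\<dots> = (\<Sum>w\<in>T. (p n x w)\<^sup>2 * mu w * (\<Sum>z\<in>S. trans_prob w z))"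
    unfolding sum_distrib_left by (simp only: mult.assoc)
  also have "\<dots> \<le> (\<Sum>w\<in>T. (p n x w)\<^sup>2 * mu w * 1)"
    using mu_pos sum_trans_prob_le[OF S] by (intro sum_mono mult_left_mono) (auto simp: less_imp_le)
  also have "\<dots> = p (2 * n) x x"
    by (subst p_diag[OF T]) (auto simp: T_def intro!: p_eq_0_far)
  finally show ?thesis .
qed

lemma p_diag_antimono: "m \<le> n \<Longrightarrow> p (2 * n) x x \<le> p (2 * m) x x"
  using decseq_SucI[of "\<lambda>n. p (2 * n) x x", OF p_diag_Suc_le] by (simp add: decseq_def)

text \<open>A caloric sequence \<open>f\<close> is decomposed at the first exit from \<open>A\<close> before time \<open>m\<close>: either the
  walk is still in \<open>A\<close> at time \<open>m\<close>, or it has left at some time \<open>k \<le> m\<close> to a boundary point, where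
  \<open>H\<close> bounds the remaining value.  The proof is an induction on the first step.\<close>

lemma first_exit_bound:
  assumes f: "\<And>k z. f (Suc k) z = step (f k) z"
    and A: "finite A"
    and H: "\<And>k w. k \<le> m \<Longrightarrow> w \<notin> A \<Longrightarrow> w \<in> vclosure A \<Longrightarrow> f (n - k) w \<le> H"
    and m: "m \<le> n" and x: "x \<in> vclosure A"
  shows "f n x \<le> (\<Sum>w\<in>A. kill A m x w * f (n - m) w) + (1 - surv A m x) * H"
  using H m x
proof (induction m arbitrary: n x)
  case (0 n x)
  show ?case
  proof (cases "x \<in> A")
    case True
    then show ?thesis using A by (simp add: kill_0 surv_0 if_distrib[of "\<lambda>c. c * _"] cong: if_cong)
  next
    case False
    then show ?thesis using 0 by (simp add: kill_0 surv_0)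
  qed
next
  case (Suc m n x)
  then obtain n' where n: "n = Suc n'" by (cases n) auto
  show ?case
  proof (cases "x \<in> A")
    case True
    have "f n x \<le> step (\<lambda>z. (\<Sum>w\<in>A. f (n' - m) w * kill A m z w) + (H - H * surv A m z)) x"
      unfolding n f
    proof (rule step_mono)
      fix z assume "adj x z"
      then have z: "z \<in> vclosure A" using True by (auto simp: vclosure_def)
      have "f n' z \<le> (\<Sum>w\<in>A. kill A m z w * f (n' - m) w) + (1 - surv A m z) * H"
      proof (rule Suc.IH[OF _ _ z])
        show "m \<le> n'" using Suc.prems(2) n by simp
        show "f (n' - k) w \<le> H" if "k \<le> m" "w \<notin> A" "w \<in> vclosure A" for k w
          using Suc.prems(1)[of "Suc k" w] that n by simp
      qed
      then show "f n' z \<le> (\<Sum>w\<in>A. f (n' - m) w * kill A m z w) + (H - H * surv A m z)"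
        by (simp add: algebra_simps)
    qed
    also have "\<dots> = (\<Sum>w\<in>A. f (n' - m) w * step (\<lambda>z. kill A m z w) x) + (H - H * step (surv A m) x)"
      by (simp add: step_add step_sum step_cmult step_diff step_const)
    finally show ?thesis using True by (simp add: n kill_Suc surv_Suc algebra_simps)
  next
    case False
    then show ?thesis using Suc.prems(1)[of 0 x] Suc.prems(3) by (simp add: kill_outside surv_outside)
  qed
qed

end

section \<open>Volume and time scales\<close>

locale doubling_graph = uniform_graph +
  fixes D C :: real
  assumes VD_const: "R > 0 \<Longrightarrow> V x (2 * R) \<le> D * V x R"
    and C_ge_4: "C \<ge> 4"
    and TC_const: "R > 0 \<Longrightarrow> y \<in> gball x R \<Longrightarrow> E x (2 * R) / E y R \<le> ennreal C"
begin

lemma V_eq: "V x R = (\<Sum>y\<in>gball x R. mu y)"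
  by (simp add: V_def)

lemma V_mono_subset: "gball x R \<subseteq> gball y S \<Longrightarrow> V x R \<le> V y S"
  unfolding V_eq using mu_pos by (intro sum_mono2) (auto simp: less_imp_le)

lemma V_mono: "R \<le> S \<Longrightarrow> V x R \<le> V x S"
  by (intro V_mono_subset gball_mono)

lemma V_move: "real (gdist y x) + R \<le> S \<Longrightarrow> V x R \<le> V y S"
  by (intro V_mono_subset gball_subset)

lemma V_pos: "R > 0 \<Longrightarrow> V x R > 0"
  unfolding V_eq using mu_pos self_in_gball[of R x] by (intro sum_pos) auto

lemma gball_1: "gball x 1 = {x}"
  by (auto simp: gball_def)

lemma V_1: "V x 1 = mu x"
  by (simp add: V_eq gball_1)

lemma D_ge_1: "D \<ge> 1"
proof -
  obtain x :: 'a where True by blast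
  have "V x 1 \<le> V x 2" by (rule V_mono) simp
  also have "\<dots> \<le> D * V x 1" using VD_const[of 1 x] by simp
  finally show ?thesis using V_pos[of 1 x] by simp
qed

lemma V_power: "R > 0 \<Longrightarrow> V x (2 ^ k * R) \<le> D ^ k * V x R"
proof (induction k)
  case (Suc k)
  have "V x (2 * (2 ^ k * R)) \<le> D * V x (2 ^ k * R)" using Suc.prems by (intro VD_const) simp
  also have "\<dots> \<le> D * (D ^ k * V x R)" using Suc D_ge_1 by (intro mult_left_mono) auto
  finally show ?case by (simp add: mult.assoc)
qed simp

lemma c0_le_1: "c0 \<le> 1"
proof -
  obtain x :: 'a where True by blast
  obtain y where "adj x y" using ex_other_neighbour by blast
  then show ?thesis using c0_le_trans_prob[of x y] sum_trans_prob_le[of "{y}" x] by simp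
qed

subsection \<open>Mean exit times are finite\<close>

lemma surv_singleton: "surv {x} n x \<le> (1 - c0) ^ n"
proof (induction n)
  case (Suc n)
  obtain y where y: "adj x y" "y \<noteq> x" using ex_other_neighbour by blast
  have tp: "trans_prob x x \<le> 1 - c0"
    using sum_trans_prob_le[of "{x, y}" x] c0_le_trans_prob[OF y(1)] y(2) by simp
  have "surv {x} (Suc n) x = (\<Sum>y\<in>nbr x. if y = x then trans_prob x x * surv {x} n x else 0)"
    unfolding surv_Suc step_def by (simp only: singletonI if_True)
      (rule sum.cong, auto simp: surv_outside)
  also have "\<dots> \<le> trans_prob x x * surv {x} n x"
    using trans_prob_nonneg surv_nonneg by simp
  also have "\<dots> \<le> (1 - c0) * (1 - c0) ^ n"
    using tp Suc c0_le_1 by (intro mult_mono) (auto simp: trans_prob_nonneg surv_nonneg)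
  finally show ?case by simp
qed (simp add: surv_0)

lemma E_1_le: "E x 1 \<le> ennreal (1 / c0)"
proof -
  have c: "norm (1 - c0) < 1" using c0_pos c0_le_1 by simp
  have "E x 1 \<le> (\<Sum>n. ennreal ((1 - c0) ^ n))"
    unfolding E_eq_suminf gball_1 by (intro suminf_le ennreal_leI surv_singleton) auto
  also have "\<dots> = ennreal (\<Sum>n. (1 - c0) ^ n)"
    using c c0_le_1 by (intro suminf_ennreal2 summable_geometric) auto
  also have "(\<Sum>n. (1 - c0) ^ n) = 1 / c0"
    using suminf_geometric[OF c] by simp
  finally show ?thesis .
qed

lemma E_mono: "R \<le> S \<Longrightarrow> E x R \<le> E x S"
  unfolding E_eq_suminf by (intro suminf_le ennreal_leI surv_mono_set gball_mono) auto

lemma E_ge_1: "R > 0 \<Longrightarrow> 1 \<le> E x R"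
proof -
  assume "R > 0"
  then have "1 = (\<Sum>n<1. ennreal (surv (gball x R) n x))"
    using self_in_gball[of R x] by (simp add: surv_0)
  also have "\<dots> \<le> E x R" unfolding E_eq_suminf by (rule sum_le_suminf) auto
  finally show ?thesis .
qed

lemma E_double:
  assumes R: "R > 0" and y: "y \<in> gball x R" and fin: "E y R \<noteq> top"
  shows "E x (2 * R) \<le> ennreal C * E y R"
proof -
  have ne: "E y R \<noteq> 0" using E_ge_1[OF R, of y] by auto
  have "E x (2 * R) = E x (2 * R) / E y R * E y R"
    using ne fin by (simp add: ennreal_divide_times ennreal_divide_self less_top)
  also have "\<dots> \<le> ennreal C * E y R" by (rule mult_right_mono[OF TC_const[OF R y]]) simp
  finally show ?thesis .
qed

text \<open>The quotient in the time comparison condition is finite, so finiteness at scale one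
  propagates to all dyadic scales.\<close>

lemma E_finite: "E x R \<noteq> top"
proof -
  have "E x (2 ^ k) \<noteq> top" for k :: nat
  proof (induction k)
    case 0 show ?case using E_1_le[of x] by (auto simp: top_unique)
  next
    case (Suc k)
    have "E x (2 * 2 ^ k) \<le> ennreal C * E x (2 ^ k)"
      by (rule E_double[OF _ self_in_gball Suc]) auto
    also have "\<dots> < top" using Suc by (simp add: ennreal_mult_less_top less_top)
    finally show ?case by simp
  qed
  moreover obtain k :: nat where "R < 2 ^ k" using real_arch_pow[of 2 R] by auto
  ultimately show ?thesis using E_mono[of R "2 ^ k" x] by (metis less_imp_le top.extremum_uniqueI)
qed

lemma transient_gball: "transient (gball x R)"
  unfolding transient_def
proof (intro conjI allI)
  fix z
  show "summable (\<lambda>n. surv (gball x R) n z)"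
  proof (cases "z \<in> gball x R")
    case True
    then have sub: "gball x R \<subseteq> gball z (2 * R)"
      by (intro gball_subset) (simp add: gball_def gdist_sym)
    have "summable (\<lambda>n. surv (gball z (2 * R)) n z)"
      using E_finite[of z "2 * R"] unfolding E_eq_suminf
      by (intro summable_suminf_not_top) (auto simp: surv_nonneg)
    then show ?thesis
      by (rule summable_comparison_test'[where N = 0]) (simp add: surv_nonneg surv_mono_set[OF sub])
  qed (simp add: surv_outside)
qed simp

text \<open>The mean exit time from a ball, started at its centre, as a real number (\<open>E_eq\<close>).\<close>

definition tau :: "'a \<Rightarrow> real \<Rightarrow> real" where
  "tau x R = mean_exit (gball x R) x"

lemma E_eq: "E x R = ennreal (tau x R)"
  unfolding E_eq_suminf tau_def mean_exit_def
  by (intro suminf_ennreal2 transient_summable[OF transient_gball]) (rule surv_nonneg)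

lemma tau_nonneg: "0 \<le> tau x R"
  unfolding tau_def by (rule mean_exit_nonneg[OF transient_gball])

lemma tau_mono: "R \<le> S \<Longrightarrow> tau x R \<le> tau x S"
  unfolding tau_def by (intro mean_exit_mono_set transient_gball gball_mono)

lemma tau_ge_1: "R > 0 \<Longrightarrow> 1 \<le> tau x R"
  using E_ge_1[of R x] tau_nonneg[of x R] by (simp add: E_eq)

lemma tau_0: "R \<le> 0 \<Longrightarrow> tau x R = 0"
proof -
  assume "R \<le> 0"
  then have "x \<notin> gball x R" by (simp add: gball_def)
  then show ?thesis by (simp add: tau_def mean_exit_outside)
qed

lemma tau_1: "tau x 1 \<le> 1 / c0"
  using E_1_le[of x] c0_pos by (simp add: E_eq)

lemma tau_double:
  assumes "R > 0" "real (gdist x y) < R"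
  shows "tau x (2 * R) \<le> C * tau y R"
  using E_double[OF assms(1) _ E_finite, of y x] assms(2) C_ge_4
  by (simp add: gball_def E_eq tau_nonneg flip: ennreal_mult)

lemma tau_power: "R > 0 \<Longrightarrow> tau x (2 ^ k * R) \<le> C ^ k * tau x R"
proof (induction k)
  case (Suc k)
  have "tau x (2 * (2 ^ k * R)) \<le> C * tau x (2 ^ k * R)" using Suc.prems by (intro tau_double) simp_all
  also have "\<dots> \<le> C * (C ^ k * tau x R)" using Suc C_ge_4 by (intro mult_left_mono) auto
  finally show ?case by (simp add: mult.assoc)
qed simp

lemma surv_gball_1: "real (gdist x z) + real n < R \<Longrightarrow> surv (gball x R) n z = 1"
proof (induction n arbitrary: z)
  case 0 then show ?case by (simp add: surv_0 gball_def)
next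
  case (Suc n)
  have "surv (gball x R) n w = 1" if "adj z w" for w
    using Suc.prems gdist_adj_le[OF that, of x] by (intro Suc.IH) simp
  then have "step (surv (gball x R) n) z = 1" using step_cong[of z "surv (gball x R) n" "\<lambda>_. 1"] by (simp add: step_const)
  then show ?case using Suc.prems by (simp add: surv_Suc gball_def)
qed

lemma tau_ge_nat: "real n \<le> tau x (real n)"
proof -
  have "real n = (\<Sum>k<n. surv (gball x (real n)) k x)"
    by (simp add: surv_gball_1)
  also have "\<dots> \<le> tau x (real n)"
    unfolding tau_def by (rule mean_exit_ge_sum[OF transient_gball])
  finally show ?thesis .
qed

text \<open>Time comparison bounds the mean exit time uniformly over the starting points of a ball.\<close>

lemma mean_exit_gball_le:
  assumes "R > 0"
  shows "mean_exit (gball x R) z \<le> C * tau x R"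
proof (cases "z \<in> gball x R")
  case True
  then have "gball x R \<subseteq> gball z (2 * R)" by (intro gball_subset) (simp add: gball_def gdist_sym)
  then have "mean_exit (gball x R) z \<le> tau z (2 * R)" unfolding tau_def by (intro mean_exit_mono_set transient_gball)
  also have "\<dots> \<le> C * tau x R" using True assms by (intro tau_double) (auto simp: gball_def gdist_sym)
  finally show ?thesis .
next
  case False then show ?thesis using tau_nonneg[of x R] C_ge_4 by (simp add: mean_exit_outside)
qed

text \<open>The difference of the mean exit times from two concentric balls is harmonic in the
  smaller one, and on its boundary it is comparable to the mean exit time from the
  smaller ball; so mean exit times grow at least geometrically.\<close>

lemma tau_growth:
  assumes R: "R \<ge> 1"
  shows "(1 + 1 / C) * tau x R \<le> tau x (4 * R)"
proof -
  define f where "f z = mean_exit (gball x (4 * R)) z - mean_exit (gball x R) z - tau x R / C" for z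
  have sub: "gball x R \<subseteq> gball x (4 * R)" using R by (intro gball_mono) simp
  have "0 \<le> f x"
  proof (rule max_principle[OF transient_gball[of x R]])
    fix z assume "z \<in> gball x R"
    then show "step f z \<le> f z"
      unfolding f_def[abs_def] using sub
      by (simp add: step_diff step_const mean_exit_step[OF transient_gball] subset_iff)
  next
    fix y assume y: "y \<in> vclosure (gball x R)" "y \<notin> gball x R"
    then obtain w where w: "w \<in> gball x R" "adj w y" by (auto simp: vclosure_def)
    have d: "real (gdist x y) < R + 1" using w(1) gdist_adj_le[OF w(2), of x] by (simp add: gball_def)
    have "tau x R \<le> tau x (2 * (R + 1))" using R by (intro tau_mono) simp
    also have "\<dots> \<le> C * tau y (R + 1)" using d R by (intro tau_double) auto
    also have "tau y (R + 1) \<le> mean_exit (gball x (4 * R)) y"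
      unfolding tau_def using d R by (intro mean_exit_mono_set transient_gball gball_subset) simp
    finally have "tau x R / C \<le> mean_exit (gball x (4 * R)) y" using C_ge_4 by (simp add: field_simps)
    then show "0 \<le> f y" using y(2) by (simp add: f_def mean_exit_outside)
  next
    show "x \<in> gball x R" using R by (intro self_in_gball) simp
  qed
  then show ?thesis by (simp add: f_def tau_def algebra_simps)
qed

lemma tau_growth_power: "R \<ge> 1 \<Longrightarrow> (1 + 1 / C) ^ k * tau x R \<le> tau x (4 ^ k * R)"
proof (induction k)
  case (Suc k)
  have "1 * 1 \<le> (4::real) ^ k * R" using Suc.prems by (intro mult_mono) auto
  then have "(1 + 1 / C) * tau x (4 ^ k * R) \<le> tau x (4 * (4 ^ k * R))" by (intro tau_growth) simp
  moreover have "(1 + 1 / C) * ((1 + 1 / C) ^ k * tau x R) \<le> (1 + 1 / C) * tau x (4 ^ k * R)"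
    using Suc C_ge_4 by (intro mult_left_mono) auto
  ultimately show ?case by (simp add: mult.assoc)
qed simp

subsection \<open>The inverse of the mean exit time\<close>

definition phi :: "'a \<Rightarrow> nat \<Rightarrow> real" where
  "phi x n = V x (real (e x n))"

lemma e_eq: "e x n = (LEAST R. real n \<le> tau x (real R))"
  unfolding e_def E_eq ennreal_of_nat_eq_real_of_nat
  by (simp add: tau_nonneg)

lemma tau_e_ge: "real n \<le> tau x (real (e x n))"
  unfolding e_eq by (rule LeastI[of _ n]) (rule tau_ge_nat)

lemma e_le: "real n \<le> tau x (real R) \<Longrightarrow> e x n \<le> R"
  unfolding e_eq by (rule Least_le)

lemma e_le_self: "e x n \<le> n"
  by (intro e_le tau_ge_nat)

lemma tau_less_e: "R < e x n \<Longrightarrow> tau x (real R) < real n"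
  using e_le[of n x R] by fastforce

lemma e_ge_1: "n \<ge> 1 \<Longrightarrow> e x n \<ge> 1"
  using tau_e_ge[of n x] tau_0[of 0 x] by (cases "e x n") auto

lemma e_mono: "m \<le> n \<Longrightarrow> e x m \<le> e x n"
  using tau_e_ge[of n x] by (intro e_le) linarith

lemma phi_mono: "m \<le> n \<Longrightarrow> phi x m \<le> phi x n"
  unfolding phi_def by (intro V_mono) (simp add: e_mono)

lemma phi_pos: "n \<ge> 1 \<Longrightarrow> phi x n > 0"
  unfolding phi_def using e_ge_1[of n x] by (intro V_pos) simp

lemma phi_1: "phi x 1 = mu x"
  using e_ge_1[of 1 x] e_le_self[of x 1] by (simp add: phi_def V_1)

text \<open>The radius \<open>e x n\<close> is the first one at which the mean exit time reaches \<open>n\<close>, and enlarging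
  a radius by one at most doubles it; so the overshoot is bounded by time comparison.  Radius one
  is separate, since the preceding radius is then zero.\<close>

lemma tau_e_le: "n \<ge> 1 \<Longrightarrow> tau x (real (e x n)) \<le> C / c0 * real n"
proof (cases "e x n \<ge> 2")
  case True
  have "tau x (real (e x n)) \<le> tau x (2 * real (e x n - 1))" using True by (intro tau_mono) simp
  also have "\<dots> \<le> C * tau x (real (e x n - 1))" using True by (intro tau_double) simp_all
  also have "\<dots> \<le> C * real n" using tau_less_e[of "e x n - 1" x n] True C_ge_4 by (intro mult_left_mono) auto
  also have "\<dots> \<le> C / c0 * real n"
    using c0_pos c0_le_1 C_ge_4 by (intro mult_right_mono) (auto simp: field_simps)
  finally show ?thesis .
next
  case False
  assume n: "n \<ge> 1"
  with False e_ge_1[OF n, of x] have "e x n = 1" by simp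
  then have "tau x (real (e x n)) \<le> 1 / c0" using tau_1[of x] by simp
  also have "\<dots> \<le> C / c0 * real n"
    using c0_pos n C_ge_4 mult_mono[of 1 C 1 "real n"] by (simp add: field_simps)
  finally show ?thesis .
qed

text \<open>Passing from radius \<open>e y j\<close> to \<open>R\<close> in steps of ratio four multiplies the volume by at most
  \<open>D\<^sup>2\<close> and the mean exit time by at least \<open>1 + 1 / C\<close> per step.  Hence the volume ratio is bounded by
  a power of the time ratio.\<close>

lemma V_le_phi:
  obtains K :: real and \<kappa> :: nat where "K \<ge> 1"
    "\<And>y R j. j \<ge> 1 \<Longrightarrow> V y R \<le> K * max 1 (tau y R / real j) ^ \<kappa> * phi y j"
proof -
  define g where "g = 1 + 1 / C"
  have g: "g > 1" using C_ge_4 by (simp add: g_def)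
  obtain \<kappa> :: nat where \<kappa>: "D ^ 2 < g ^ \<kappa>" using real_arch_pow[OF g] by blast
  have D2: "1 \<le> D ^ 2" using D_ge_1 by simp
  show thesis
  proof (rule that[OF D2])
    fix y R and j :: nat assume j: "j \<ge> 1"
    let ?M = "max 1 (tau y R / real j)"
    define r where "r = real (e y j)"
    have r: "r \<ge> 1" using e_ge_1[OF j, of y] by (simp add: r_def)
    have phi: "phi y j = V y r" by (simp add: phi_def r_def)
    show "V y R \<le> D ^ 2 * ?M ^ \<kappa> * phi y j"
    proof (cases "R \<le> r")
      case True
      have "V y R \<le> 1 * phi y j" using V_mono[OF True] by (simp add: phi)
      also have "\<dots> \<le> D ^ 2 * ?M ^ \<kappa> * phi y j"
        using mult_mono[OF D2 one_le_power[of ?M \<kappa>]] D2 phi_pos[OF j, of y]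
        by (intro mult_right_mono) auto
      finally show ?thesis .
    next
      case False
      obtain k :: nat where "R / r < 4 ^ k" using real_arch_pow[of 4 "R / r"] by auto
      then have "\<exists>k::nat. R \<le> 4 ^ k * r" using r by (intro exI[of _ k]) (simp add: field_simps)
      then obtain i where i: "R \<le> 4 ^ i * r" and least: "\<And>k. k < i \<Longrightarrow> \<not> R \<le> 4 ^ k * r"
        using exists_least_iff[of "\<lambda>k. R \<le> 4 ^ k * r"] by blast
      have "i \<noteq> 0" using i False by (intro notI) simp
      then obtain i' where i': "i = Suc i'" by (cases i) auto
      have le: "4 ^ i' * r \<le> R" using least[of i'] i' by simp
      have "g ^ i' * real j \<le> g ^ i' * tau y r"
        using tau_e_ge[of j y] g by (intro mult_left_mono) (auto simp: r_def)
      also have "\<dots> \<le> tau y (4 ^ i' * r)" unfolding g_def by (rule tau_growth_power[OF r])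
      also have "\<dots> \<le> tau y R" by (rule tau_mono[OF le])
      finally have gi: "g ^ i' \<le> ?M" using j by (simp add: field_simps le_max_iff_disj)
      have "V y R \<le> V y (2 ^ (2 * i) * r)" using i by (intro V_mono) (simp add: power_mult)
      also have "\<dots> \<le> D ^ (2 * i) * phi y j" unfolding phi using r by (intro V_power) simp
      also have "D ^ (2 * i) = D ^ 2 * (D ^ 2) ^ i'"
        unfolding i' power_mult by (rule power_Suc)
      also have "(D ^ 2) ^ i' \<le> (g ^ \<kappa>) ^ i'" using \<kappa> D2 by (intro power_mono) auto
      also have "(g ^ \<kappa>) ^ i' = (g ^ i') ^ \<kappa>" by (simp add: power_mult[symmetric] mult.commute)
      also have "\<dots> \<le> ?M ^ \<kappa>" using gi g by (intro power_mono) auto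
      finally show ?thesis using phi_pos[OF j, of y] D2
        by (simp add: mult_left_mono mult_right_mono)
    qed
  qed
qed

text \<open>The ball of radius \<open>e x n\<close> around \<open>x\<close> is enlarged until it has \<open>z\<close> well inside, which costs a
  factor in time only, and then \<open>V_le_phi\<close> is applied at \<open>z\<close>.\<close>

lemma phi_compare:
  obtains K :: real and \<kappa> :: nat where "K \<ge> 1"
    "\<And>x z \<rho> n j. real (gdist x z) \<le> \<rho> \<Longrightarrow> j \<ge> 1 \<Longrightarrow> n \<ge> 1 \<Longrightarrow> n \<le> 3 * j \<Longrightarrow>
      phi x n \<le> K * max 1 (tau x \<rho> / real n) ^ \<kappa> * phi z j"
proof -
  obtain K \<kappa> where K: "K \<ge> 1"
    and V: "\<And>y R j. j \<ge> 1 \<Longrightarrow> V y R \<le> K * max 1 (tau y R / real j) ^ \<kappa> * phi y j"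
    using V_le_phi by blast
  define L where "L = 3 * C\<^sup>2 * (C / c0)"
  have Cc0: "C / c0 \<ge> 1" using C_ge_4 c0_le_1 c0_pos by (simp add: field_simps)
  have C2: "C\<^sup>2 \<ge> 1" using C_ge_4 by simp
  have L: "L \<ge> 1" using mult_mono[of 1 "C\<^sup>2" 1 "C / c0"] C2 Cc0 unfolding L_def by linarith
  have KL: "1 \<le> K * L ^ \<kappa>" using mult_mono[OF K one_le_power[OF L, of \<kappa>]] K by simp
  show thesis
  proof (rule that[OF KL])
    fix x z \<rho> and n j :: nat
    assume d: "real (gdist x z) \<le> \<rho>" and j: "j \<ge> 1" and n: "n \<ge> 1" and nj: "n \<le> 3 * j"
    let ?M = "max 1 (tau x \<rho> / real n)"
    define r where "r = max \<rho> (real (e x n))"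
    have r: "r \<ge> 1" "\<rho> \<le> r" "real (e x n) \<le> r" using e_ge_1[OF n, of x] by (auto simp: r_def)
    have "phi x n \<le> V z (2 * r)"
      unfolding phi_def using d r by (intro V_move) (simp add: gdist_sym)
    also have "\<dots> \<le> K * max 1 (tau z (2 * r) / real j) ^ \<kappa> * phi z j" by (rule V[OF j])
    also have "max 1 (tau z (2 * r) / real j) \<le> L * ?M"
    proof -
      have "tau z (2 * r) \<le> tau z (2 * (2 * r))" using r by (intro tau_mono) simp
      also have "\<dots> \<le> C * tau x (2 * r)" using r d by (intro tau_double) (auto simp: gdist_sym)
      also have "\<dots> \<le> C * (C * tau x r)" using r C_ge_4 by (intro mult_left_mono tau_double) auto
      also have "tau x r \<le> C / c0 * (real n * ?M)"
      proof (cases "\<rho> \<le> real (e x n)")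
        case True
        then have "tau x r \<le> C / c0 * real n" using tau_e_le[OF n, of x] by (simp add: r_def max_def)
        also have "\<dots> \<le> C / c0 * (real n * ?M)" using Cc0 n by (intro mult_left_mono) auto
        finally show ?thesis .
      next
        case False
        then have "tau x r \<le> 1 * (real n * (tau x \<rho> / real n))" using n by (simp add: r_def max_def)
        also have "\<dots> \<le> C / c0 * (real n * ?M)" using Cc0 n tau_nonneg by (intro mult_mono mult_left_mono) auto
        finally show ?thesis .
      qed
      finally have t: "tau z (2 * r) \<le> C * (C * (C / c0 * (real n * ?M)))" using C_ge_4 by simp
      also have "\<dots> \<le> C * (C * (C / c0 * ((3 * real j) * ?M)))"
        using nj C_ge_4 Cc0 by (intro mult_left_mono mult_right_mono) auto
      finally have "tau z (2 * r) / real j \<le> L * ?M"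
        using j by (simp add: L_def divide_le_eq power2_eq_square mult_ac)
      moreover have "1 \<le> L * ?M" using mult_mono[of 1 L 1 ?M] L by simp
      ultimately show ?thesis by simp
    qed
    then have "max 1 (tau z (2 * r) / real j) ^ \<kappa> \<le> (L * ?M) ^ \<kappa>" by (intro power_mono) auto
    finally show "phi x n \<le> K * L ^ \<kappa> * ?M ^ \<kappa> * phi z j"
      using K phi_pos[OF j, of z] by (simp add: power_mult_distrib mult.assoc mult_left_mono mult_right_mono)
  qed
qed

lemma DUE_iff: "DUE \<longleftrightarrow> (\<exists>K>0. \<forall>x. \<forall>n>0. p n x x \<le> K / phi x n)"
  by (simp add: DUE_def phi_def)

text \<open>In \<open>p_le_of_even_diag\<close> an odd time \<open>2 * a + 1\<close> is split into \<open>a\<close> and \<open>a + 1\<close>, and Cauchy--Schwarz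
  leads to the return probability at time \<open>2 * a\<close>; this is why \<open>phi\<close> is taken at \<open>2 * a + 1\<close>.  For
  \<open>a = 0\<close> both sides are explicit, as \<open>p 0 x x = 1 / mu x = 1 / phi x 1\<close>.\<close>

lemma DUE_imp_even_diag:
  assumes DUE
  obtains K where "K > 0" "\<And>a x. p (2 * a) x x \<le> K / phi x (2 * a + 1)"
proof -
  obtain K where K: "K > 0" "\<And>x n. n > 0 \<Longrightarrow> p n x x \<le> K / phi x n"
    using assms unfolding DUE_iff by blast
  obtain L \<kappa> where L: "L \<ge> 1" and phi: "\<And>x z \<rho> n j. real (gdist x z) \<le> \<rho> \<Longrightarrow> j \<ge> 1 \<Longrightarrow> n \<ge> 1 \<Longrightarrow> n \<le> 3 * j \<Longrightarrow>
      phi x n \<le> L * max 1 (tau x \<rho> / real n) ^ \<kappa> * phi z j" using phi_compare by blast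
  show thesis
  proof (rule that[of "max 1 (K * L)"])
    fix a x
    show "p (2 * a) x x \<le> max 1 (K * L) / phi x (2 * a + 1)"
    proof (cases "a = 0")
      case True
      then show ?thesis using mu_pos[of x] by (simp add: p_0 phi_1[unfolded One_nat_def] divide_right_mono)
    next
      case False
      have ph: "phi x (2 * a + 1) \<le> L * phi x (2 * a)"
        using phi[of x x 0 "2 * a" "2 * a + 1"] False by (simp add: tau_0)
      have pos: "phi x (2 * a) > 0" "phi x (2 * a + 1) > 0" using False by (auto intro: phi_pos)
      have "p (2 * a) x x \<le> K / phi x (2 * a)" using False by (intro K) simp
      also have "\<dots> \<le> K * L / phi x (2 * a + 1)"
        using ph pos K(1) by (simp add: field_simps)
      also have "\<dots> \<le> max 1 (K * L) / phi x (2 * a + 1)" using pos by (intro divide_right_mono) auto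
      finally show ?thesis .
    qed
  qed simp
qed

lemma p_le_of_even_diag:
  assumes K: "K > 0" "p (2 * (n div 2)) x x \<le> K / phi x (2 * (n div 2) + 1)"
    "p (2 * (n - n div 2)) y y \<le> K / phi y (2 * (n - n div 2) + 1)"
    and n: "n \<ge> 1"
  shows "p n x y \<le> K / sqrt (phi x n * phi y n)"
proof -
  let ?a = "n div 2" and ?b = "n - n div 2"
  have px: "p (2 * ?a) x x \<le> K / phi x n"
    using K(1) n phi_mono[of n "2 * ?a + 1" x] phi_pos[OF n, of x]
    by (intro order_trans[OF K(2)] divide_left_mono mult_pos_pos phi_pos) auto
  have py: "p (2 * ?b) y y \<le> K / phi y n"
    using K(1) n phi_mono[of n "2 * ?b + 1" y] phi_pos[OF n, of y]
    by (intro order_trans[OF K(3)] divide_left_mono mult_pos_pos phi_pos) auto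
  have "(p n x y)\<^sup>2 \<le> p (2 * ?a) x x * p (2 * ?b) y y"
    using p_Cauchy_Schwarz[of ?a ?b x y] by simp
  also have "\<dots> \<le> (K / phi x n) * (K / phi y n)"
    using px py K(1) phi_pos[OF n, of x] by (intro mult_mono) (auto simp: p_nonneg)
  also have "\<dots> = (K / sqrt (phi x n * phi y n))\<^sup>2"
    using phi_pos[OF n, of x] phi_pos[OF n, of y] by (simp add: power_divide power2_eq_square)
  finally show ?thesis
    by (rule power2_le_imp_le) (use K(1) phi_pos[OF n, of x] phi_pos[OF n, of y] in simp)
qed

section \<open>From the mean value inequality to the diagonal estimate\<close>

text \<open>The sum \<open>F\<close> of the heat kernel over the times from \<open>n\<close> to \<open>2 * n\<close> is not harmonic, but
  \<open>F - step F\<close> telescopes to \<open>p n - p (2 * n)\<close>.  Its Green potential is subtracted; the remainder is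
  harmonic, and it is nonnegative because it agrees with \<open>F\<close> on the boundary.\<close>

lemma heat_average_le:
  assumes CM: "CM > 0"
    and MV: "\<And>u. harmonic_on u (gball x s) \<Longrightarrow> (\<And>y. y \<in> vclosure (gball x s) \<Longrightarrow> 0 \<le> u y) \<Longrightarrow>
        u x \<le> CM / V x s * (\<Sum>\<^sub>\<infinity>y\<in>gball x s. u y * mu y)"
    and s: "s > 0"
    and M: "\<And>z. z \<in> gball x s \<Longrightarrow> p n x z \<le> M"
  shows "(\<Sum>k\<in>{n..<2*n}. p k x x) \<le> CM / V x s * (real n + C * tau x s) + M * tau x s"
proof -
  define B where "B = gball x s"
  have B: "transient B" "finite B" unfolding B_def by (auto intro: transient_gball)
  have xB: "x \<in> B" using s by (simp add: B_def self_in_gball)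
  define F where "F z = (\<Sum>k\<in>{n..<2*n}. p k x z)" for z
  define g where "g z = p n x z - p (2*n) x z" for z
  define h where "h z = F z - green_op B g z" for z
  have F0: "0 \<le> F z" for z by (simp add: F_def sum_nonneg p_nonneg)
  have stepF: "step F z = F z - g z" for z
  proof -
    have "step F z = (\<Sum>k\<in>{n..<2*n}. p (Suc k) x z)"
      unfolding F_def[abs_def] by (simp add: step_sum step_p)
    also have "\<dots> - F z = p (2*n) x z - p n x z"
      unfolding F_def sum_subtractf[symmetric] by (rule sum_Suc_diff') simp
    ultimately show ?thesis by (simp add: g_def)
  qed
  have harm: "step h z = h z" if "z \<in> B" for z
    unfolding h_def[abs_def] using that by (simp add: step_diff stepF green_op_step[OF B(1)])
  have h0: "0 \<le> h z" for z
  proof (cases "z \<in> B")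
    case True
    show ?thesis
    proof (rule max_principle[OF B(1) _ _ True])
      show "0 \<le> h y" if "y \<notin> B" for y using that F0 by (simp add: h_def green_op_outside)
    qed (simp add: harm)
  qed (simp add: h_def green_op_outside F0)
  have mvx: "h x \<le> CM / V x s * (\<Sum>y\<in>B. h y * mu y)"
    using MV[of h] by (simp add: harmonic_on_iff h0 harm B_def[symmetric] B)
  have mass: "(\<Sum>y\<in>B. h y * mu y) \<le> real n + C * tau x s"
  proof -
    have "(\<Sum>y\<in>B. h y * mu y) \<le> (\<Sum>y\<in>B. F y * mu y + mu y * green_op B (p (2*n) x) y)"
    proof (rule sum_mono)
      fix y
      have "h y = F y - green_op B (p n x) y + green_op B (p (2*n) x) y"
        by (simp add: h_def g_def[abs_def] green_op_diff)
      also have "\<dots> \<le> F y + green_op B (p (2*n) x) y"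
        using green_op_nonneg[OF B(1), of "p n x" y] by (simp add: p_nonneg)
      finally have "h y * mu y \<le> (F y + green_op B (p (2*n) x) y) * mu y"
        using mu_pos[of y] by (intro mult_right_mono) auto
      then show "h y * mu y \<le> F y * mu y + mu y * green_op B (p (2*n) x) y" by (simp add: algebra_simps)
    qed
    also have "\<dots> = (\<Sum>k\<in>{n..<2*n}. \<Sum>y\<in>B. p k x y * mu y) + (\<Sum>z\<in>B. mu z * p (2*n) x z * mean_exit B z)"
      unfolding sum.distrib sum_mu_green_op[OF B(1)] F_def sum_distrib_right by (subst sum.swap) simp
    also have "(\<Sum>k\<in>{n..<2*n}. \<Sum>y\<in>B. p k x y * mu y) \<le> (\<Sum>k\<in>{n..<2*n}. 1)"
      by (intro sum_mono sum_p_le_1 B)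
    also have "(\<Sum>z\<in>B. mu z * p (2*n) x z * mean_exit B z) \<le> (\<Sum>z\<in>B. (p (2*n) x z * mu z) * (C * tau x s))"
    proof (rule sum_mono)
      fix z
      have "(p (2*n) x z * mu z) * mean_exit B z \<le> (p (2*n) x z * mu z) * (C * tau x s)"
        unfolding B_def using s mu_pos[of z] by (intro mult_left_mono mean_exit_gball_le) (auto simp: p_nonneg)
      then show "mu z * p (2*n) x z * mean_exit B z \<le> (p (2*n) x z * mu z) * (C * tau x s)" by (simp add: mult_ac)
    qed
    also have "\<dots> \<le> 1 * (C * tau x s)"
      unfolding sum_distrib_right[symmetric] using C_ge_4 tau_nonneg
      by (intro mult_right_mono sum_p_le_1 B) auto
    finally show ?thesis by simp
  qed
  have hx: "h x \<le> CM / V x s * (real n + C * tau x s)"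
    by (rule order_trans[OF mvx mult_left_mono[OF mass]]) (use CM V_pos[OF s, of x] in simp)
  have "F x = h x + green_op B (p n x) x - green_op B (p (2*n) x) x"
    by (simp add: h_def g_def[abs_def] green_op_diff)
  also have "\<dots> \<le> h x + green_op B (p n x) x"
    using green_op_nonneg[OF B(1), of "p (2*n) x" x] by (simp add: p_nonneg)
  also have "green_op B (p n x) x \<le> M * tau x s"
    unfolding tau_def B_def[symmetric] by (rule green_op_le_mean_exit[OF B(1)]) (simp add: B_def M)
  finally show ?thesis using hx by (simp add: F_def)
qed

lemma sum_even_ge:
  assumes "2 * b \<le> a"
  shows "real b * p (2 * a) x x \<le> (\<Sum>k\<in>{2*b..<2*(2*b)}. p k x x)"
proof -
  have "real b * p (2 * a) x x = (\<Sum>i\<in>{b..<2*b}. p (2 * a) x x)" by simp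
  also have "\<dots> \<le> (\<Sum>i\<in>{b..<2*b}. p (2 * i) x x)"
    using assms by (intro sum_mono p_diag_antimono) auto
  also have "\<dots> = (\<Sum>k\<in>(\<lambda>i. 2 * i) ` {b..<2*b}. p k x x)"
    by (subst sum.reindex) (auto simp: inj_on_def)
  also have "\<dots> \<le> (\<Sum>k\<in>{2*b..<2*(2*b)}. p k x x)"
    by (intro sum_mono2) (auto simp: p_nonneg)
  finally show ?thesis .
qed

text \<open>Induction on the time.  The radius \<open>s\<close> is chosen with \<open>tau x s\<close> at most \<open>L2 / q\<close> times the
  time, where \<open>q\<close> is so large that the potential term of \<open>heat_average_le\<close> contributes at most
  half of the constant \<open>K\<close>; the other half then has to dominate the mean value term, in which the
  volume at the smaller scale \<open>s\<close> costs the factor \<open>W\<close>.\<close>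

lemma MV_imp_DUE:
  assumes MV
  shows DUE
proof -
  obtain CM where CM: "CM > 0" and mv: "\<forall>x. \<forall>R>0. \<forall>u.
     harmonic_on u (gball x R) \<and> (\<forall>y\<in>vclosure (gball x R). u y \<ge> 0) \<longrightarrow>
     u x \<le> CM / V x R * (\<Sum>\<^sub>\<infinity>y\<in>gball x R. u y * mu y)"
    using assms unfolding MV_def by blast
  obtain K0 \<kappa>0 where K0: "K0 \<ge> 1"
    and Vphi: "\<And>y R j. j \<ge> 1 \<Longrightarrow> V y R \<le> K0 * max 1 (tau y R / real j) ^ \<kappa>0 * phi y j"
    using V_le_phi by blast
  obtain L \<kappa> where L: "L \<ge> 1" and phi: "\<And>x z \<rho> n j. real (gdist x z) \<le> \<rho> \<Longrightarrow> j \<ge> 1 \<Longrightarrow> n \<ge> 1 \<Longrightarrow> n \<le> 3 * j \<Longrightarrow>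
      phi x n \<le> L * max 1 (tau x \<rho> / real n) ^ \<kappa> * phi z j" using phi_compare by blast
  define L2 where "L2 = C / c0"
  have L2: "L2 \<ge> 1" using C_ge_4 c0_le_1 c0_pos by (simp add: L2_def field_simps)
  have tau_e: "tau x (real (e x n)) \<le> L2 * real n" if "n \<ge> 1" for x n
    using tau_e_le[OF that] by (simp add: L2_def)
  \<comment> \<open>\<open>2 * L2 * L \<le> q\<close> makes the potential term at most \<open>K / 2\<close>\<close>
  define q where "q = nat \<lceil>2 * L2 * L\<rceil>"
  have q: "2 * L2 * L \<le> real q" by (simp add: q_def real_nat_ceiling_ge)
  have LL: "1 \<le> L2 * L" "L2 \<le> L2 * L" using L L2 mult_mono[of 1 L2 1 L] by auto
  have q2: "q \<ge> 2" "L2 \<le> real q" using q LL L2 by linarith+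
  define W where "W = K0 * (14 * real q * L2) ^ \<kappa>0"
  have W: "W > 0" using K0 L2 q2 by (simp add: W_def)
  define K where "K = max (D ^ (4 * q)) (2 * (CM * (2 + C) * W))"
  have K: "K > 0" "D ^ (4 * q) \<le> K" "CM * (2 + C) * W \<le> K / 2"
    using D_ge_1 by (auto simp: K_def less_max_iff_disj)
  have main: "p (2 * a) x x \<le> K / phi x (2 * a + 1)" for a x
  proof (induction a arbitrary: x rule: less_induct)
    case (less a)
    define b where "b = a div 2"
    have ph: "phi x (2 * a + 1) > 0" by (rule phi_pos) simp
    show ?case
    proof (cases "b < q")
      case True
      \<comment> \<open>at bounded times the trivial bound \<open>1 / mu x\<close> suffices\<close>
      then have a: "2 * a + 1 \<le> 4 * q" by (simp add: b_def)
      have "real (e x (2 * a + 1)) \<le> real (2 * a + 1)" using e_le_self[of x "2 * a + 1"] by (simp only: of_nat_le_iff)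
      also have "\<dots> \<le> real (2 ^ (4 * q))"
        using a less_exp[of "4 * q"] by (simp only: of_nat_le_iff)
      finally have "phi x (2 * a + 1) \<le> V x (2 ^ (4 * q) * 1)"
        unfolding phi_def by (intro V_mono) simp
      also have "\<dots> \<le> D ^ (4 * q) * mu x" using V_power[of 1 x "4 * q"] by (simp add: V_1)
      also have "\<dots> \<le> K * mu x" using K mu_pos[of x] by (intro mult_right_mono) auto
      finally have "1 / mu x \<le> K / phi x (2 * a + 1)" using ph mu_pos[of x] by (simp add: field_simps)
      then show ?thesis using p_le[of "2 * a" x] by linarith
    next
      case False
      have b: "b \<ge> 2" "b \<ge> q" "2 * b \<le> a" "a \<le> 2 * b + 1" "b < a" using False q2 by (auto simp: b_def)
      define j where "j = b div q"
      have j: "j \<ge> 1" using b q2 by (simp add: j_def div_greater_zero_iff Suc_le_eq)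
      have jb: "j * q \<le> b" by (simp add: j_def)
      have bj: "b \<le> 2 * (q * j)"
      proof -
        have "b = q * j + b mod q" by (simp add: j_def)
        moreover have "b mod q < q" using q2 by simp
        moreover have "q * 1 \<le> q * j" using j by (intro mult_left_mono) auto
        ultimately show ?thesis by linarith
      qed
      define s where "s = real (e x j)"
      have s: "s \<ge> 1" using e_ge_1[OF j, of x] by (simp add: s_def)
      have "real j * real q \<le> real b" using jb by (simp flip: of_nat_mult)
      then have jle: "real j \<le> real b / real q" using q2 by (simp add: field_simps)
      have taus: "tau x s \<le> L2 * real b / real q"
        using tau_e[OF j, of x] mult_left_mono[OF jle, of L2] L2 unfolding s_def by simp
      have taus': "tau x s \<le> real b"
      proof -
        have "L2 * real b / real q \<le> real b" using q2 by (simp add: divide_le_eq mult.commute[of "real b"] mult_right_mono)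
        then show ?thesis using taus by linarith
      qed
      \<comment> \<open>passing to the smaller scale costs a constant that depends on \<open>q\<close> only\<close>
      have phiV: "phi x (2 * a + 1) \<le> W * V x s"
      proof -
        have "phi x (2 * a + 1) \<le> K0 * max 1 (tau x (real (e x (2 * a + 1))) / real j) ^ \<kappa>0 * phi x j"
          unfolding phi_def[of x "2 * a + 1"] by (rule Vphi[OF j])
        also have "max 1 (tau x (real (e x (2 * a + 1))) / real j) \<le> 14 * real q * L2"
        proof -
          have "tau x (real (e x (2 * a + 1))) \<le> L2 * real (2 * a + 1)" by (rule tau_e) simp
          also have "\<dots> \<le> L2 * real (14 * (q * j))"
            using bj b L2 by (intro mult_left_mono of_nat_mono) linarith+
          finally have "tau x (real (e x (2 * a + 1))) / real j \<le> 14 * real q * L2"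
            using j by (simp add: divide_le_eq mult_ac)
          moreover have "1 \<le> 14 * real q * L2" using q2 L2 mult_mono[of 1 "14 * real q" 1 L2] by simp
          ultimately show ?thesis by simp
        qed
        then have "max 1 (tau x (real (e x (2 * a + 1))) / real j) ^ \<kappa>0 \<le> (14 * real q * L2) ^ \<kappa>0"
          by (intro power_mono) auto
        finally show ?thesis unfolding W_def s_def phi_def[symmetric] using K0 phi_pos[OF j, of x]
          by (simp add: mult_left_mono mult_right_mono)
      qed
      \<comment> \<open>this constant must not depend on \<open>q\<close>, as it multiplies the term that is absorbed\<close>
      have phiz: "phi x (2 * a + 1) \<le> L * phi z (2 * b)" if "real (gdist x z) \<le> s" for z
      proof -
        have "tau x s / real (2 * a + 1) \<le> 1" using taus' b by (simp add: divide_le_eq)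
        then have "max 1 (tau x s / real (2 * a + 1)) = 1" by simp
        then show ?thesis using phi[OF that, of "2 * b" "2 * a + 1"] b by simp
      qed
      have M: "p (2 * b) x z \<le> K * L / phi x (2 * a + 1)" if "z \<in> gball x s" for z
      proof -
        have IH: "p (2 * b) y y \<le> K / phi y (2 * b + 1)" for y using less b by blast
        have "p (2 * b) x z \<le> K / sqrt (phi x (2 * b) * phi z (2 * b))"
          by (rule p_le_of_even_diag[OF K(1)]) (use IH b in \<open>auto simp: mult_2\<close>)
        also have "\<dots> \<le> K / sqrt ((phi x (2 * a + 1) / L) * (phi x (2 * a + 1) / L))"
        proof -
          have "phi x (2 * a + 1) / L \<le> phi x (2 * b)" "phi x (2 * a + 1) / L \<le> phi z (2 * b)"
            using phiz[of x] phiz[of z] that s L by (auto simp: gball_def field_simps)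
          moreover have "0 < phi x (2 * a + 1) / L" using ph L by simp
          ultimately show ?thesis using K(1)
            by (intro divide_left_mono real_sqrt_le_mono mult_mono mult_pos_pos real_sqrt_gt_zero) auto
        qed
        also have "sqrt ((phi x (2 * a + 1) / L) * (phi x (2 * a + 1) / L)) = phi x (2 * a + 1) / L"
          unfolding real_sqrt_abs2 using ph L by simp
        finally show ?thesis by simp
      qed
      have "real b * p (2 * a) x x \<le> (\<Sum>k\<in>{2*b..<2*(2*b)}. p k x x)"
        by (rule sum_even_ge[OF b(3)])
      also have "\<dots> \<le> CM / V x s * (real (2 * b) + C * tau x s) + K * L / phi x (2 * a + 1) * tau x s"
      proof (rule heat_average_le[OF CM])
        show "u x \<le> CM / V x s * (\<Sum>\<^sub>\<infinity>y\<in>gball x s. u y * mu y)"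
          if "harmonic_on u (gball x s)" "\<And>y. y \<in> vclosure (gball x s) \<Longrightarrow> 0 \<le> u y" for u
          using mv[rule_format, of s u x] that s by simp
      qed (use s M in auto)
      also have "CM / V x s * (real (2 * b) + C * tau x s) \<le> CM * W / phi x (2 * a + 1) * ((2 + C) * real b)"
      proof (rule mult_mono)
        show "CM / V x s \<le> CM * W / phi x (2 * a + 1)"
          using phiV ph V_pos[of s x] s CM by (simp add: field_simps)
        show "real (2 * b) + C * tau x s \<le> (2 + C) * real b"
          using taus' C_ge_4 by (simp add: algebra_simps mult_left_mono)
      qed (use CM W ph C_ge_4 tau_nonneg in auto)
      also have "K * L / phi x (2 * a + 1) * tau x s \<le> K * L / phi x (2 * a + 1) * (L2 * real b / real q)"
        using taus K L ph by (intro mult_left_mono) auto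
      finally have "real b * p (2 * a) x x \<le>
          real b * ((CM * (2 + C) * W + K * (L2 * L / real q)) / phi x (2 * a + 1))"
        by (simp add: add_divide_distrib distrib_left mult_ac)
      then have "p (2 * a) x x \<le> (CM * (2 + C) * W + K * (L2 * L / real q)) / phi x (2 * a + 1)"
        by (rule mult_left_le_imp_le) (use b in simp)
      also have "\<dots> \<le> (K / 2 + K * (1 / 2)) / phi x (2 * a + 1)"
      proof (intro divide_right_mono add_mono mult_left_mono)
        show "L2 * L / real q \<le> 1 / 2" using q q2 by (simp add: field_simps)
      qed (use K ph in auto)
      finally show ?thesis by simp
    qed
  qed
  show DUE
    unfolding DUE_iff
  proof (intro exI[of _ K] conjI allI impI K(1))
    fix x and n :: nat assume n: "n > 0"
    have "p n x x \<le> K / sqrt (phi x n * phi x n)"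
      by (rule p_le_of_even_diag[OF K(1) main main]) (use n in simp)
    then show "p n x x \<le> K / phi x n" using phi_pos[of n x] n by simp
  qed
qed

section \<open>The tail of the exit time\<close>

text \<open>The function \<open>\<psi>\<close> equals one outside \<open>B(y,r)\<close>, is at least one half, and satisfies
  \<open>step \<psi> \<le> (1 + b) * \<psi>\<close> inside.  Comparing with it shows that each layer of width \<open>r + 1\<close> which the
  walk has to cross gains the factor \<open>\<psi> y = 1 - 1 / (2 * C)\<close>.\<close>

lemma exit_layers:
  assumes r: "r > 0" and b: "b \<ge> 0"
    and small: "\<And>y. y \<in> gball x R \<Longrightarrow> 1 / (C * tau y r) \<le> b"
    and y: "real (gdist x y) + real j * (r + 1) < R"
  shows "1 - surv (gball x R) n y \<le> (1 + b) ^ n * (1 - 1 / (2 * C)) ^ j"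
  using y
proof (induction j arbitrary: n y)
  case 0
  have "1 - surv (gball x R) n y \<le> 1" using surv_nonneg by simp
  also have "1 \<le> (1 + b) ^ n" using b by simp
  finally show ?case by simp
next
  case (Suc j)
  note outer = Suc.IH
  let ?\<theta> = "1 - 1 / (2 * C)"
  have \<theta>: "0 \<le> ?\<theta>" using C_ge_4 by (simp add: field_simps)
  have dist: "real (gdist x y) + real j * (r + 1) + (r + 1) < R"
    using Suc.prems by (simp add: algebra_simps)
  have jr: "0 \<le> real j * (r + 1)" using r by simp
  have near: "z \<in> gball x R" if "z \<in> gball y r" for z
  proof -
    have "real (gdist x z) \<le> real (gdist x y) + real (gdist y z)"
      using gdist_triangle[of x z y] by (simp flip: of_nat_add)
    moreover have "real (gdist y z) < r" using that by (simp add: gball_def)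
    ultimately have "real (gdist x z) < R" using dist jr by linarith
    then show ?thesis by (simp add: gball_def)
  qed
  have yR: "y \<in> gball x R" by (rule near[OF self_in_gball[OF r]])
  have t: "tau y r \<ge> 1" by (rule tau_ge_1[OF r])
  \<comment> \<open>half of the reciprocal of the bound in \<open>mean_exit_gball_le\<close>, which keeps \<open>\<psi>\<close> above one half\<close>
  define a where "a = 1 / (2 * (C * tau y r))"
  have a: "a > 0" "2 * a \<le> b" using small[OF yR] t C_ge_4 by (auto simp: a_def)
  define \<psi> where "\<psi> z = 1 - a * mean_exit (gball y r) z" for z
  have \<psi>_ge: "1 / 2 \<le> \<psi> z" for z
  proof -
    have "a * mean_exit (gball y r) z \<le> a * (C * tau y r)" using a by (intro mult_left_mono mean_exit_gball_le r) simp
    also have "\<dots> = 1 / 2" using t C_ge_4 by (simp add: a_def)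
    finally show ?thesis by (simp add: \<psi>_def)
  qed
  have \<psi>_out: "\<psi> z = 1" if "z \<notin> gball y r" for z using that by (simp add: \<psi>_def mean_exit_outside)
  have step_\<psi>: "step \<psi> z \<le> (1 + b) * \<psi> z" if "z \<in> gball y r" for z
  proof -
    have "step \<psi> z = \<psi> z + a"
      using that by (simp add: \<psi>_def[abs_def] step_diff step_const step_cmult mean_exit_step[OF transient_gball] algebra_simps)
    also have "\<dots> \<le> \<psi> z + 2 * a * \<psi> z" using mult_left_mono[OF \<psi>_ge[of z], of "2 * a"] a by simp
    also have "\<dots> \<le> \<psi> z + b * \<psi> z" using a \<psi>_ge[of z] by (intro add_left_mono mult_right_mono) auto
    finally show ?thesis by (simp add: algebra_simps)
  qed
  have inner: "1 - surv (gball x R) n z \<le> (1 + b) ^ n * ?\<theta> ^ j * \<psi> z" if "z \<in> gball y r" for n z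
    using that
  proof (induction n arbitrary: z)
    case 0
    have "z \<in> gball x R" by (rule near[OF 0])
    then show ?case using \<theta> \<psi>_ge[of z] by (simp add: surv_0)
  next
    case (Suc n)
    have zR: "z \<in> gball x R" by (rule near[OF Suc.prems])
    have "1 - surv (gball x R) (Suc n) z = step (\<lambda>w. 1 - surv (gball x R) n w) z"
      using zR by (simp add: surv_Suc step_diff step_const)
    also have "\<dots> \<le> step (\<lambda>w. (1 + b) ^ n * ?\<theta> ^ j * \<psi> w) z"
    proof (rule step_mono)
      fix w assume w: "adj z w"
      show "1 - surv (gball x R) n w \<le> (1 + b) ^ n * ?\<theta> ^ j * \<psi> w"
      proof (cases "w \<in> gball y r")
        case True then show ?thesis by (rule Suc.IH)
      next
        case False
        have "real (gdist x w) \<le> real (gdist x y) + real (gdist y z) + 1"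
          using gdist_triangle[of x w y] gdist_adj_le[OF w, of y] by simp
        moreover have "real (gdist y z) < r" using Suc.prems by (simp add: gball_def)
        ultimately have "real (gdist x w) + real j * (r + 1) < R" using dist by linarith
        from outer[OF this, of n]
        show ?thesis using \<psi>_out[OF False] by simp
      qed
    qed
    also have "\<dots> = (1 + b) ^ n * ?\<theta> ^ j * step \<psi> z" by (rule step_cmult)
    also have "\<dots> \<le> (1 + b) ^ n * ?\<theta> ^ j * ((1 + b) * \<psi> z)"
      using b \<theta> by (intro mult_left_mono step_\<psi> Suc.prems) auto
    finally show ?case by (simp add: mult_ac)
  qed
  have "\<psi> y = ?\<theta>" using t C_ge_4 by (simp add: \<psi>_def a_def tau_def[symmetric])
  then show ?case using inner[OF self_in_gball[OF r], of n] by (simp add: mult_ac)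
qed

text \<open>With \<open>r = R / 2 ^ (k + 2)\<close> there are \<open>2 ^ k\<close> layers to cross, each gaining a fixed factor, while
  the rate \<open>b\<close> is about \<open>C ^ k / tau x R\<close>.  The gain \<open>2 ^ k\<close> beats the loss \<open>n * b\<close> as long as
  \<open>(C / 2) ^ k\<close> is a small multiple of \<open>tau x R / n\<close>, and the largest such \<open>k\<close> satisfies
  \<open>2 ^ k = (tau x R / n) powr \<eta>\<close> up to a constant, where \<open>(C / 2) powr \<eta> = 2\<close>.\<close>

lemma exit_tail:
  obtains \<eta> c K where "\<eta> > 0" "c > 0" "K > 0"
    "\<And>x R n. n \<ge> 1 \<Longrightarrow> 1 - surv (gball x R) n x \<le> K * exp (- c * (tau x R / real n) powr \<eta>)"
proof -
  define \<gamma> where "\<gamma> = C / 2"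
  have \<gamma>: "\<gamma> \<ge> 2" using C_ge_4 by (simp add: \<gamma>_def)
  define \<eta> where "\<eta> = log \<gamma> 2"
  have \<eta>: "\<eta> > 0" using \<gamma> by (simp add: \<eta>_def)
  have \<gamma>\<eta>: "(\<gamma> ^ m) powr \<eta> = 2 ^ m" for m
  proof -
    have "(\<gamma> ^ m) powr \<eta> = (\<gamma> powr \<eta>) ^ m"
      using \<gamma> by (simp add: powr_powr powr_realpow[symmetric] powr_power mult.commute)
    then show ?thesis using \<gamma> by (simp add: \<eta>_def)
  qed
  \<comment> \<open>\<open>16 * C\<close> makes the loss at most half of the gain; \<open>C / c0\<close> ensures that \<open>r \<ge> 1\<close> below\<close>
  define A where "A = 16 * C / c0"
  have A: "A > 0" "C / c0 \<le> A" "16 * C \<le> A" using C_ge_4 c0_pos c0_le_1 by (auto simp: A_def field_simps)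
  define c where "c = 1 / (32 * C * A powr \<eta>)"
  have c: "c > 0" using A C_ge_4 by (simp add: c_def)
  have up: "c * X powr \<eta> \<le> 2 ^ m / (32 * C)" if "0 \<le> X" "X \<le> A * \<gamma> ^ m" for X m
  proof -
    have "X powr \<eta> \<le> (A * \<gamma> ^ m) powr \<eta>" using that \<eta> by (intro powr_mono2) auto
    also have "\<dots> = A powr \<eta> * 2 ^ m" using A \<gamma> by (simp add: powr_mult \<gamma>\<eta>)
    finally have "c * X powr \<eta> \<le> c * (A powr \<eta> * 2 ^ m)" using c by (intro mult_left_mono) auto
    also have "\<dots> = 2 ^ m / (32 * C)" using A C_ge_4 by (simp add: c_def)
    finally show ?thesis .
  qed
  show thesis
  proof (rule that[OF \<eta> c, of "exp 1"])
    fix x R and n :: nat assume n: "n \<ge> 1"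
    define X where "X = tau x R / real n"
    have X0: "X \<ge> 0" using tau_nonneg by (simp add: X_def)
    have "1 - surv (gball x R) n x \<le> exp 1 * exp (- c * X powr \<eta>)"
    proof (cases "X \<le> A * \<gamma> ^ 2")
      case True
      \<comment> \<open>the right-hand side is at least one\<close>
      have "c * X powr \<eta> \<le> 2 ^ 2 / (32 * C)" by (rule up[OF X0 True])
      also have "\<dots> \<le> 1" using C_ge_4 by simp
      finally have "1 \<le> exp (1 + - c * X powr \<eta>)" by simp
      then have "1 \<le> exp 1 * exp (- c * X powr \<eta>)" by (simp only: exp_add)
      then show ?thesis using surv_nonneg[of "gball x R" n x] by linarith
    next
      case False
      obtain m :: nat where "X / A < \<gamma> ^ m" using real_arch_pow[of \<gamma> "X / A"] \<gamma> by auto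
      then have "\<exists>m. X \<le> A * \<gamma> ^ m" using A by (intro exI[of _ m]) (simp add: field_simps)
      then obtain i where i: "X \<le> A * \<gamma> ^ i" and least: "\<And>k. k < i \<Longrightarrow> \<not> X \<le> A * \<gamma> ^ k"
        using exists_least_iff[of "\<lambda>k. X \<le> A * \<gamma> ^ k"] by blast
      have "3 \<le> i"
      proof (rule ccontr)
        assume "\<not> 3 \<le> i"
        then have "A * \<gamma> ^ i \<le> A * \<gamma> ^ 2" using A \<gamma> by (intro mult_left_mono power_increasing) auto
        then show False using i False by simp
      qed
      then obtain k where k: "i = k + 3" using le_Suc_ex[of 3 i] by (auto simp: add.commute)
      have lo: "A * \<gamma> ^ (k + 2) < X" using least[of "k + 2"] k by simp
      show ?thesis
      proof (cases "real n < R")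
        case True
        \<comment> \<open>too few steps to reach the boundary\<close>
        then have "surv (gball x R) n x = 1" by (intro surv_gball_1) simp
        then show ?thesis by simp
      next
        case nR: False
        have R1: "R \<ge> 1"
        proof (rule ccontr)
          assume "\<not> R \<ge> 1"
          then have "tau x R \<le> 1 / c0" using tau_mono[of R 1 x] tau_1[of x] by linarith
          also have "\<dots> \<le> C / c0" using C_ge_4 c0_pos by (intro divide_right_mono) auto
          also have "\<dots> \<le> A * \<gamma> ^ (k + 2) * real n"
          proof -
            have "1 * 1 \<le> \<gamma> ^ (k + 2) * real n" using \<gamma> n by (intro mult_mono one_le_power) auto
            then have "A * 1 \<le> A * (\<gamma> ^ (k + 2) * real n)" using A by (intro mult_left_mono) auto
            with A(2) have "C / c0 \<le> A * (\<gamma> ^ (k + 2) * real n)" by linarith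
            then show ?thesis by (simp only: mult.assoc)
          qed
          finally show False using lo n by (simp add: X_def field_simps)
        qed
        obtain m0 :: nat where "R < 2 ^ m0" using real_arch_pow[of 2 R] by auto
        then obtain m1 where m1: "R < 2 ^ m1" and least1: "\<And>k. k < m1 \<Longrightarrow> \<not> R < 2 ^ k"
          using exists_least_iff[of "\<lambda>k. R < 2 ^ k"] by blast
        have "m1 \<noteq> 0" using m1 R1 by (intro notI) simp
        then obtain m where m: "m1 = Suc m" by (cases m1) auto
        have mR: "2 ^ m \<le> R" using least1[of m] m by simp
        have mn: "(2::real) ^ m \<le> real n" using mR nR by linarith
        have "tau x R \<le> tau x (2 ^ Suc m * 1)" using m1 m by (intro tau_mono) simp
        also have "\<dots> \<le> C ^ Suc m * tau x 1" by (intro tau_power) simp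
        also have "\<dots> \<le> C ^ Suc m * (1 / c0)" using C_ge_4 by (intro mult_left_mono tau_1) auto
        also have "\<dots> = C / c0 * \<gamma> ^ m * 2 ^ m" by (simp add: \<gamma>_def power_divide)
        also have "\<dots> \<le> A * \<gamma> ^ m * real n" using A \<gamma> mn by (intro mult_mono) auto
        finally have "X \<le> A * \<gamma> ^ m" using n by (simp add: X_def divide_le_eq)
        with lo have "A * \<gamma> ^ (k + 2) < A * \<gamma> ^ m" by linarith
        then have "\<gamma> ^ (k + 2) < \<gamma> ^ m" using A by simp
        then have "k + 2 < m" using \<gamma> by (subst (asm) power_strict_increasing_iff) auto
        then have "(2::real) ^ (k + 2) \<le> 2 ^ m" by (intro power_increasing) auto
        with mR have kR: "2 ^ (k + 2) \<le> R" by linarith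
        define r where "r = R / 2 ^ (k + 2)"
        have r: "r \<ge> 1" "R = 2 ^ (k + 2) * r" using kR by (auto simp: r_def field_simps)
        define b where "b = C ^ (k + 2) / tau x R"
        have tR: "tau x R \<ge> 1" using R1 by (intro tau_ge_1) simp
        have b: "b \<ge> 0" using tR C_ge_4 by (simp add: b_def)
        have small: "1 / (C * tau y r) \<le> b" if "y \<in> gball x R" for y
        proof -
          have ty: "tau y r \<ge> 1" using r by (intro tau_ge_1) simp
          have "tau x R \<le> tau x (2 * R)" using R1 by (intro tau_mono) simp
          also have "\<dots> \<le> C * tau y R" using that R1 by (intro tau_double) (auto simp: gball_def)
          also have "tau y R \<le> C ^ (k + 2) * tau y r" unfolding r(2) using r by (intro tau_power) simp
          finally have "tau x R \<le> C * (C ^ (k + 2) * tau y r)" using C_ge_4 by simp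
          then show ?thesis using tR ty C_ge_4 by (simp add: b_def field_simps)
        qed
        have layer: "real (2 ^ k) * (r + 1) < R"
        proof -
          have "real (2 ^ k) * (r + 1) \<le> real (2 ^ k) * (2 * r)" using r by (intro mult_left_mono) auto
          also have "\<dots> < R" using r by (simp add: power_add)
          finally show ?thesis .
        qed
        have bn: "b * real n \<le> 2 ^ k / (4 * C)"
        proof -
          have "b * real n = C ^ (k + 2) / X" using n by (simp add: b_def X_def)
          also have "\<dots> \<le> C ^ (k + 2) / (A * \<gamma> ^ (k + 2))"
            using lo A \<gamma> C_ge_4 by (intro divide_left_mono) (auto intro!: mult_pos_pos less_trans[OF _ lo])
          also have "\<dots> = 2 ^ (k + 2) / A" using C_ge_4 by (simp add: \<gamma>_def power_divide)
          also have "\<dots> \<le> 2 ^ (k + 2) / (16 * C)" using A C_ge_4 by (intro divide_left_mono) auto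
          finally show ?thesis by (simp add: power_add)
        qed
        have "1 - surv (gball x R) n x \<le> (1 + b) ^ n * (1 - 1 / (2 * C)) ^ (2 ^ k)"
          by (rule exit_layers[OF _ b small]) (use r layer in auto)
        also have "\<dots> \<le> exp b ^ n * exp (- (1 / (2 * C))) ^ (2 ^ k)"
        proof (intro mult_mono power_mono)
          show "1 - 1 / (2 * C) \<le> exp (- (1 / (2 * C)))" using exp_ge_add_one_self[of "- (1 / (2 * C))"] by simp
        qed (use b C_ge_4 in \<open>auto simp: field_simps\<close>)
        also have "\<dots> = exp (b * real n - 2 ^ k / (2 * C))"
          by (simp add: exp_of_nat_mult[symmetric] exp_add[symmetric] mult.commute)
        also have "\<dots> \<le> exp (- c * X powr \<eta>)"
        proof (rule exp_le_cancel_iff[THEN iffD2])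
          have "c * X powr \<eta> \<le> 2 ^ i / (32 * C)" by (rule up[OF X0 i])
          also have "\<dots> = 2 ^ k / (4 * C)" by (simp add: k power_add)
          finally show "b * real n - 2 ^ k / (2 * C) \<le> - c * X powr \<eta>"
            using bn by (simp add: field_simps)
        qed
        also have "\<dots> \<le> exp 1 * exp (- c * X powr \<eta>)" by (simp add: one_le_exp_iff)
        finally show ?thesis .
      qed
    qed
    then show "1 - surv (gball x R) n x \<le> exp 1 * exp (- c * (tau x R / real n) powr \<eta>)"
      by (simp add: X_def)
  qed simp
qed

end

section \<open>The off-diagonal estimate\<close>

text \<open>With \<open>Y = t powr \<eta>\<close> the claim is that a power of \<open>Y\<close> is at most a multiple of \<open>exp (c / 2 * Y)\<close>.\<close>

lemma polynomial_absorbed: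
  fixes \<eta> c :: real and \<kappa> :: nat
  assumes \<eta>: "\<eta> > 0" and c: "c > 0"
  obtains K where "K \<ge> 1"
    "\<And>t. t \<ge> 0 \<Longrightarrow> max 1 t ^ \<kappa> * exp (- c * t powr \<eta>) \<le> K * exp (- (c / 2) * t powr \<eta>)"
proof -
  define m where "m = Suc (nat \<lceil>real \<kappa> / \<eta>\<rceil>)"
  have m: "m \<ge> 1" "real \<kappa> \<le> \<eta> * real m"
  proof -
    have "real \<kappa> / \<eta> \<le> real m" unfolding m_def by linarith
    then show "real \<kappa> \<le> \<eta> * real m" using \<eta> by (simp add: field_simps)
  qed (simp add: m_def)
  define K where "K = max 1 ((2 * real m / c) ^ m)"
  show thesis
  proof (rule that[of K])
    fix t :: real assume t: "t \<ge> 0"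
    define Y where "Y = t powr \<eta>"
    have Y: "Y \<ge> 0" by (simp add: Y_def)
    have "max 1 t ^ \<kappa> \<le> K * exp (c / 2 * Y)"
    proof (cases "t \<le> 1")
      case True
      have "1 * 1 \<le> K * exp (c / 2 * Y)" using c Y by (intro mult_mono) (auto simp: K_def)
      then show ?thesis using True by simp
    next
      case False
      have "max 1 t ^ \<kappa> = t powr real \<kappa>" using False by (simp add: powr_realpow)
      also have "\<dots> \<le> t powr (\<eta> * real m)" using False m by (intro powr_mono) auto
      also have "\<dots> = Y ^ m" using False by (simp add: Y_def powr_powr[symmetric] powr_realpow)
      also have "\<dots> = (2 * real m / c) ^ m * (c / 2 * Y / real m) ^ m"
        unfolding power_mult_distrib[symmetric] using m c by simp
      also have "(c / 2 * Y / real m) ^ m \<le> (1 + c / 2 * Y / real m) ^ m"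
        using c Y by (intro power_mono) auto
      also have "\<dots> \<le> exp (c / 2 * Y)"
      proof (rule exp_ge_one_plus_x_over_n_power_n)
        have "0 \<le> c / 2 * Y" using c Y by simp
        then show "- real m \<le> c / 2 * Y" by linarith
      qed (use m in simp)
      finally have "max 1 t ^ \<kappa> \<le> (2 * real m / c) ^ m * exp (c / 2 * Y)"
        using c by (simp add: mult_left_mono)
      also have "\<dots> \<le> K * exp (c / 2 * Y)" by (intro mult_right_mono) (auto simp: K_def)
      finally show ?thesis .
    qed
    then have "max 1 t ^ \<kappa> * exp (- c * Y) \<le> K * exp (c / 2 * Y) * exp (- c * Y)"
      by (intro mult_right_mono) auto
    also have "\<dots> = K * exp (- (c / 2) * Y)" by (simp add: mult.assoc exp_add[symmetric] field_simps)
    finally show "max 1 t ^ \<kappa> * exp (- c * t powr \<eta>) \<le> K * exp (- (c / 2) * t powr \<eta>)" by (simp add: Y_def)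
  qed (simp add: K_def)
qed

context doubling_graph
begin

text \<open>A path of length \<open>n\<close> from \<open>x\<close> to \<open>y\<close> leaves \<open>A\<close> around \<open>x\<close> within the first \<open>m\<close> steps, or
  its reversal leaves \<open>A'\<close> around \<open>y\<close> within the remaining ones.\<close>

lemma p_two_exits:
  assumes A: "finite A" "x \<in> A" and A': "finite A'" "y \<in> A'" and disj: "A \<inter> A' = {}"
    and m: "m \<le> n"
    and H: "\<And>k w. k \<le> m \<Longrightarrow> w \<notin> A \<Longrightarrow> w \<in> vclosure A \<Longrightarrow> p (n - k) w y \<le> H"
    and H': "\<And>k w. k \<le> n - m \<Longrightarrow> w \<notin> A' \<Longrightarrow> w \<in> vclosure A' \<Longrightarrow> p (n - k) w x \<le> H"
  shows "p n x y \<le> (1 - surv A m x) * H + (1 - surv A' (n - m) y) * H"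
proof -
  have mux: "mu x > 0" and muy: "mu y > 0" by (rule mu_pos)+
  define S where "S = (\<Sum>w\<in>A. kill A m x w * kill UNIV (n - m) w y)"
  have first: "kill UNIV n x y \<le> S + (1 - surv A m x) * (H * mu y)"
    unfolding S_def
  proof (rule first_exit_bound[where f = "\<lambda>k z. kill UNIV k z y"])
    show "kill UNIV (n - k) w y \<le> H * mu y" if "k \<le> m" "w \<notin> A" "w \<in> vclosure A" for k w
      using H[OF that] muy by (simp add: kill_UNIV_eq)
  qed (use A m in \<open>auto simp: kill_Suc vclosure_def\<close>)
  define f where "f k z = (\<Sum>w\<in>A. kill A m w x * kill UNIV k z w)" for k z
  have S: "S = mu y / mu x * f (n - m) y"
    unfolding S_def f_def sum_distrib_left
  proof (rule sum.cong)
    fix w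
    have muw: "mu w > 0" by (rule mu_pos)
    have a: "kill A m x w = mu w / mu x * kill A m w x" using kill_sym[of x A m w] mux by (simp add: field_simps)
    have b: "kill UNIV (n - m) w y = mu y / mu w * kill UNIV (n - m) y w"
      using kill_sym[of w UNIV "n - m" y] muw by (simp add: field_simps)
    show "kill A m x w * kill UNIV (n - m) w y = mu y / mu x * (kill A m w x * kill UNIV (n - m) y w)"
      unfolding a b using muw by simp
  qed simp
  have f_le: "f i w \<le> mu x * p (i + m) w x" for i w
  proof -
    let ?T = "A \<union> {z. gdist w z \<le> i}"
    have "f i w \<le> (\<Sum>z\<in>A. kill UNIV i w z * kill UNIV m z x)"
      unfolding f_def
      by (intro sum_mono, subst mult.commute, intro mult_left_mono kill_mono_set kill_nonneg subset_UNIV)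
    also have "\<dots> \<le> (\<Sum>z\<in>?T. kill UNIV i w z * kill UNIV m z x)"
      using A by (intro sum_mono2) (auto simp: kill_nonneg)
    also have "\<dots> = kill UNIV (i + m) w x"
      using A by (intro kill_add[symmetric]) (auto intro: kill_eq_0_far)
    finally show ?thesis by (simp add: kill_UNIV_eq mult.commute)
  qed
  have "f (n - m) y \<le> (\<Sum>w\<in>A'. kill A' (n - m) y w * f (n - m - (n - m)) w) + (1 - surv A' (n - m) y) * (mu x * H)"
  proof (rule first_exit_bound)
    show "f (Suc k) z = step (f k) z" for k z
      unfolding f_def[abs_def] by (simp add: step_sum step_cmult kill_Suc)
    show "f (n - m - k) w \<le> mu x * H" if "k \<le> n - m" "w \<notin> A'" "w \<in> vclosure A'" for k w
    proof -
      have "n - m - k + m = n - k" using that(1) m by simp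
      then show ?thesis using f_le[of "n - m - k" w] H'[OF that] mux
        by (metis (no_types, opaque_lifting) less_imp_le mult_left_mono order_trans)
    qed
  qed (use A' in \<open>auto simp: vclosure_def\<close>)
  also have "(\<Sum>w\<in>A'. kill A' (n - m) y w * f (n - m - (n - m)) w) = 0"
  proof (rule sum.neutral, rule ballI)
    fix w assume "w \<in> A'"
    then have "f 0 w = 0" using disj by (auto simp: f_def kill_0 intro!: sum.neutral)
    then show "kill A' (n - m) y w * f (n - m - (n - m)) w = 0" by simp
  qed
  finally have "S \<le> mu y / mu x * ((1 - surv A' (n - m) y) * (mu x * H))"
    unfolding S using mux muy by (intro mult_left_mono) auto
  also have "\<dots> = (1 - surv A' (n - m) y) * H * mu y" using mux by simp
  finally have "kill UNIV n x y \<le> ((1 - surv A m x) * H + (1 - surv A' (n - m) y) * H) * mu y"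
    using first by (simp add: algebra_simps)
  then show ?thesis using muy by (simp add: kill_UNIV_eq)
qed

text \<open>Both exits in \<open>p_two_exits\<close> are from balls of half the distance \<open>R\<close> of \<open>x\<close> and \<open>y\<close>, so all
  positions at the exit lie within distance \<open>2 * R\<close> of \<open>x\<close>, and at least a third of the time
  remains.  There the heat kernel is at most a power of \<open>tau x R / n\<close> times \<open>1 / phi x n\<close>, and \<open>exit_tail\<close> supplies the
  exponential factor.  Distances up to one are separate: no time may be left after the exit when
  \<open>n = 1\<close>.\<close>

lemma DUE_imp_UE:
  assumes DUE
  shows UE
proof -
  obtain K where K: "K > 0" "\<And>a x. p (2 * a) x x \<le> K / phi x (2 * a + 1)"
    using DUE_imp_even_diag[OF assms] by blast
  obtain L \<kappa> where L: "L \<ge> 1" and phi: "\<And>x z \<rho> n j. real (gdist x z) \<le> \<rho> \<Longrightarrow> j \<ge> 1 \<Longrightarrow> n \<ge> 1 \<Longrightarrow> n \<le> 3 * j \<Longrightarrow>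
      phi x n \<le> L * max 1 (tau x \<rho> / real n) ^ \<kappa> * phi z j" using phi_compare by blast
  obtain \<eta> c K1 where \<eta>: "\<eta> > 0" and c: "c > 0" and K1: "K1 > 0"
    and tail: "\<And>x R n. n \<ge> 1 \<Longrightarrow> 1 - surv (gball x R) n x \<le> K1 * exp (- c * (tau x R / real n) powr \<eta>)"
    using exit_tail by blast
  define c' where "c' = c / (C ^ 3) powr \<eta>"
  have c': "c' > 0" using c C_ge_4 by (simp add: c'_def)
  obtain K2 where K2: "K2 \<ge> 1" and absorb: "\<And>t. t \<ge> 0 \<Longrightarrow>
      max 1 t ^ \<kappa> * exp (- c' * t powr \<eta>) \<le> K2 * exp (- (c' / 2) * t powr \<eta>)"
    using polynomial_absorbed[OF \<eta> c', of \<kappa>] by blast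
  \<comment> \<open>points within distance \<open>\<rho>\<close> of \<open>x\<close>, at times comparable to \<open>n\<close>\<close>
  have near: "p j w y \<le> K * L * max 1 (tau x \<rho> / real n) ^ \<kappa> / phi x n"
    if "j \<ge> 1" "n \<ge> 1" "n \<le> 3 * j" "real (gdist x w) \<le> \<rho>" "real (gdist x y) \<le> \<rho>" for j n x y w \<rho>
  proof -
    let ?M = "L * max 1 (tau x \<rho> / real n) ^ \<kappa>"
    have M: "?M > 0" using L by simp
    have pos: "phi x n > 0" using that(2) by (rule phi_pos)
    have w: "phi x n / ?M \<le> phi w j" using phi[OF that(4,1,2,3)] M by (simp add: pos_divide_le_eq mult.commute)
    have y: "phi x n / ?M \<le> phi y j" using phi[OF that(5,1,2,3)] M by (simp add: pos_divide_le_eq mult.commute)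
    have q: "phi x n / ?M > 0" using pos M by simp
    have "p j w y \<le> K / sqrt (phi w j * phi y j)"
      by (rule p_le_of_even_diag[OF K(1) K(2) K(2) that(1)])
    also have "\<dots> \<le> K / sqrt ((phi x n / ?M) * (phi x n / ?M))"
      using K(1) w y q
      by (intro divide_left_mono real_sqrt_le_mono mult_mono mult_pos_pos real_sqrt_gt_zero) auto
    also have "sqrt ((phi x n / ?M) * (phi x n / ?M)) = phi x n / ?M"
      unfolding real_sqrt_abs2 by (rule abs_of_pos[OF q])
    also have "K / (phi x n / ?M) = K * L * max 1 (tau x \<rho> / real n) ^ \<kappa> / phi x n" by simp
    finally show ?thesis .
  qed
  define U where "U = (1 / c0) ^ \<kappa> * exp (c' / 2 * (1 / c0) powr \<eta>)"
  have U: "U > 0" using c0_pos by (simp add: U_def)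
  define Z where "Z = max (K * L * U) (2 * K1 * K * L * C ^ \<kappa> * K2)"
  have Z: "Z > 0" using K L U by (simp add: Z_def less_max_iff_disj)
  have main: "p n x y \<le> Z / phi x n * exp (- (c' / 2) * (tau x (real (gdist x y)) / real n) powr \<eta>)"
    if n: "n \<ge> 1" for n x y
  proof -
    define R where "R = real (gdist x y)"
    define T where "T = tau x R / real n"
    have T0: "T \<ge> 0" using tau_nonneg by (simp add: T_def)
    have pos: "phi x n > 0" by (rule phi_pos[OF n])
    have "p n x y \<le> Z / phi x n * exp (- (c' / 2) * T powr \<eta>)"
    proof -
      consider "gdist x y \<le> 1" | "gdist x y \<ge> 2" "n = 1" | "gdist x y \<ge> 2" "n \<ge> 2" using n by linarith
      then show ?thesis
      proof cases
        case 1
        then have "R \<le> 1" by (simp add: R_def)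
        then have "tau x R \<le> 1 / c0" using tau_mono[of R 1 x] tau_1[of x] by linarith
        moreover have "T \<le> tau x R" using n tau_nonneg[of x R] mult_left_mono[of 1 "real n" "tau x R"]
          by (simp add: T_def divide_le_eq)
        ultimately have T1: "T \<le> 1 / c0" by linarith
        have c1: "1 \<le> 1 / c0" using c0_pos c0_le_1 by simp
        have "p n x y \<le> K * L * max 1 T ^ \<kappa> / phi x n"
          unfolding T_def by (rule near) (use n in \<open>auto simp: R_def\<close>)
        also have "\<dots> \<le> K * L * (1 / c0) ^ \<kappa> / phi x n"
          using K L pos T1 c1 by (intro divide_right_mono mult_left_mono power_mono) auto
        also have "(1 / c0) ^ \<kappa> \<le> U * exp (- (c' / 2) * T powr \<eta>)"
        proof -
          have "T powr \<eta> \<le> (1 / c0) powr \<eta>" using T0 T1 \<eta> by (intro powr_mono2) auto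
          then have "c' / 2 * T powr \<eta> \<le> c' / 2 * (1 / c0) powr \<eta>" using c' by (intro mult_left_mono) auto
          then have "1 \<le> exp (c' / 2 * (1 / c0) powr \<eta> + - (c' / 2) * T powr \<eta>)" by simp
          then have e: "1 \<le> exp (c' / 2 * (1 / c0) powr \<eta>) * exp (- (c' / 2) * T powr \<eta>)" by (simp only: exp_add)
          have "(1 / c0) ^ \<kappa> * 1 \<le> (1 / c0) ^ \<kappa> * (exp (c' / 2 * (1 / c0) powr \<eta>) * exp (- (c' / 2) * T powr \<eta>))"
            using c0_pos by (intro mult_left_mono e) auto
          then show ?thesis by (simp add: U_def mult.assoc)
        qed
        finally have "p n x y \<le> K * L * (U * exp (- (c' / 2) * T powr \<eta>)) / phi x n"
          using K L pos by (simp add: mult_left_mono divide_right_mono)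
        also have "\<dots> = K * L * U / phi x n * exp (- (c' / 2) * T powr \<eta>)" by simp
        also have "\<dots> \<le> Z / phi x n * exp (- (c' / 2) * T powr \<eta>)"
          using pos by (intro mult_right_mono divide_right_mono) (auto simp: Z_def)
        finally show ?thesis .
      next
        case 2
        then have "p n x y = 0" by (intro p_eq_0_far) simp
        then show ?thesis using Z pos by simp
      next
        case 3
        define r where "r = R / 2"
        define m where "m = n div 2"
        have R2: "R \<ge> 2" using 3(1) by (simp add: R_def)
        have r: "r > 0" "r + 1 \<le> R" "2 * r = R" using R2 by (auto simp: r_def)
        have m: "m \<le> n" "m \<ge> 1" "n - m \<ge> 1" "n \<le> 3 * m" "n \<le> 3 * (n - m)" using 3(2) by (auto simp: m_def)
        define H where "H = K * L * (C * max 1 T) ^ \<kappa> / phi x n"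
        have H0: "H \<ge> 0" using K L pos C_ge_4 by (simp add: H_def)
        have nearH: "p j w z \<le> H" if "j \<ge> 1" "n \<le> 3 * j" "real (gdist x w) \<le> 2 * R" "real (gdist x z) \<le> 2 * R" for j w z
        proof -
          have "p j w z \<le> K * L * max 1 (tau x (2 * R) / real n) ^ \<kappa> / phi x n"
            by (rule near[OF that(1) n that(2,3,4)])
          also have "\<dots> \<le> H"
            unfolding H_def
          proof (intro divide_right_mono mult_left_mono power_mono)
            have "tau x (2 * R) \<le> C * tau x R" using R2 by (intro tau_double) auto
            then have "tau x (2 * R) / real n \<le> C * T" by (simp add: T_def divide_right_mono)
            also have "\<dots> \<le> C * max 1 T" using C_ge_4 by (intro mult_left_mono) auto
            finally show "max 1 (tau x (2 * R) / real n) \<le> C * max 1 T"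
              using C_ge_4 mult_mono[of 1 C 1 "max 1 T"] by simp
          qed (use K L pos in auto)
          finally show ?thesis .
        qed
        have two: "p n x y \<le> (1 - surv (gball x r) m x) * H + (1 - surv (gball y r) (n - m) y) * H"
        proof (rule p_two_exits)
          show "gball x r \<inter> gball y r = {}"
          proof (rule equals0I)
            fix z assume "z \<in> gball x r \<inter> gball y r"
            then have "real (gdist x z) < r" "real (gdist z y) < r" by (auto simp: gball_def gdist_sym)
            moreover have "R \<le> real (gdist x z) + real (gdist z y)"
              using gdist_triangle[of x y z] by (simp add: R_def)
            ultimately show False using r by linarith
          qed
          show "p (n - k) w y \<le> H" if k: "k \<le> m" and w: "w \<notin> gball x r" "w \<in> vclosure (gball x r)" for k w
          proof (rule nearH)
            obtain v where v: "v \<in> gball x r" "adj v w" using w by (auto simp: vclosure_def)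
            have "real (gdist x w) \<le> real (gdist x v) + 1" using gdist_adj_le[OF v(2), of x] by simp
            then show "real (gdist x w) \<le> 2 * R" using v(1) r R2 by (simp add: gball_def)
          qed (use k m R2 in \<open>auto simp: R_def\<close>)
          show "p (n - k) w x \<le> H" if k: "k \<le> n - m" and w: "w \<notin> gball y r" "w \<in> vclosure (gball y r)" for k w
          proof (rule nearH)
            obtain v where v: "v \<in> gball y r" "adj v w" using w by (auto simp: vclosure_def)
            have "real (gdist x w) \<le> R + (real (gdist y v) + 1)"
              using gdist_adj_le[OF v(2), of y] gdist_triangle[of x w y] by (simp add: R_def)
            then show "real (gdist x w) \<le> 2 * R" using v(1) r by (simp add: gball_def)
          qed (use k m R2 in auto)
        qed (use r m in \<open>auto intro: self_in_gball\<close>)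
        define X where "X = exp (- c' * T powr \<eta>)"
        have tailX: "1 - surv (gball z r) k z \<le> K1 * X"
          if "k \<ge> 1" "k \<le> n" "tau x R \<le> C ^ 3 * tau z r" for z k
        proof -
          have "1 - surv (gball z r) k z \<le> 1 - surv (gball z r) n z" using surv_antimono[OF that(2)] by simp
          also have "\<dots> \<le> K1 * exp (- c * (tau z r / real n) powr \<eta>)" by (rule tail[OF n])
          also have "\<dots> \<le> K1 * X"
          proof -
            have "T / C ^ 3 \<le> tau z r / real n"
              using that(3) n C_ge_4 by (simp add: T_def field_simps)
            then have "(T / C ^ 3) powr \<eta> \<le> (tau z r / real n) powr \<eta>"
              using T0 \<eta> C_ge_4 by (intro powr_mono2) auto
            then have "c * (T / C ^ 3) powr \<eta> \<le> c * (tau z r / real n) powr \<eta>" using c by (intro mult_left_mono) auto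
            moreover have "c * (T / C ^ 3) powr \<eta> = c' * T powr \<eta>"
              using T0 C_ge_4 by (simp add: c'_def powr_divide)
            ultimately show ?thesis using K1 by (simp add: X_def)
          qed
          finally show ?thesis .
        qed
        have "1 - surv (gball x r) m x \<le> K1 * X"
        proof (rule tailX)
          have "tau x R \<le> C * tau x r" unfolding r(3)[symmetric] using r by (intro tau_double) auto
          also have "\<dots> \<le> C ^ 3 * tau x r" using C_ge_4 tau_nonneg power_increasing[of 1 3 C] by (intro mult_right_mono) auto
          finally show "tau x R \<le> C ^ 3 * tau x r" .
        qed (use m in auto)
        moreover have "1 - surv (gball y r) (n - m) y \<le> K1 * X"
        proof (rule tailX)
          have "tau x R \<le> tau x (2 * (2 * R))" using R2 by (intro tau_mono) simp
          also have "\<dots> \<le> C * tau y (2 * R)" using R2 by (intro tau_double) (auto simp: R_def)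
          also have "tau y (2 * R) \<le> C ^ 2 * tau y r" 
          proof -
            have "2 * R = 2 ^ 2 * r" using r(3) by simp
            then show ?thesis using tau_power[OF r(1), of y 2] by (simp only:)
          qed
          finally show "tau x R \<le> C ^ 3 * tau y r" using C_ge_4 by (simp add: power2_eq_square power3_eq_cube mult.assoc)
        qed (use m in auto)
        ultimately have "p n x y \<le> K1 * X * H + K1 * X * H"
          using two H0 by (meson add_mono mult_right_mono order_trans)
        also have "\<dots> = 2 * K1 * K * L * C ^ \<kappa> * (max 1 T ^ \<kappa> * X) / phi x n"
          by (simp add: H_def power_mult_distrib mult_ac)
        also have "\<dots> \<le> 2 * K1 * K * L * C ^ \<kappa> * (K2 * exp (- (c' / 2) * T powr \<eta>)) / phi x n"
          unfolding X_def using K1 K L C_ge_4 pos absorb[OF T0]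
          by (intro divide_right_mono mult_left_mono) auto
        also have "\<dots> = 2 * K1 * K * L * C ^ \<kappa> * K2 / phi x n * exp (- (c' / 2) * T powr \<eta>)" by simp
        also have "\<dots> \<le> Z / phi x n * exp (- (c' / 2) * T powr \<eta>)"
          using pos by (intro mult_right_mono divide_right_mono) (auto simp: Z_def)
        finally show ?thesis .
      qed
    qed
    then show ?thesis by (simp add: T_def R_def)
  qed
  have "p n x y \<le> Z / V x (real (e x n)) *
      exp (- (c' / 2) * (enn2real (E x (real (gdist x y))) / real n) powr (1 / ((1 + 1 / \<eta>) - 1)))"
    if "n > 0" for x y n
    using main[of n x y] that by (simp add: phi_def E_eq tau_nonneg)
  moreover have "1 + 1 / \<eta> > 1" "c' / 2 > 0" using \<eta> c' by auto
  ultimately show UE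
    unfolding UE_def using Z by blast
qed

lemma UE_imp_DUE:
  assumes UE
  shows DUE
proof -
  obtain K \<beta> c where K: "K > 0" and ue: "\<forall>x y. \<forall>n>0. p n x y \<le> K / V x (real (e x n)) *
       exp (- c * (enn2real (E x (real (gdist x y))) / real n) powr (1 / (\<beta> - 1)))"
    using assms unfolding UE_def by blast
  have "p n x x \<le> K / V x (real (e x n))" if "n > 0" for n x
    using ue[rule_format, OF that, of x x] by (simp add: E_eq tau_0)
  then show DUE using K unfolding DUE_def by blast
qed

section \<open>From the upper estimate to the mean value inequality\<close>

text \<open>The Green function is the sum of the killed heat kernel over all times.  Times below
  \<open>tau x R\<close> contribute at most \<open>const * mu z / V x R\<close> each.  For later times the first part of
  the walk is summed by the mean exit time, and the last \<open>n\<close> steps are bounded by the heat kernel at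
  time \<open>n\<close>.\<close>

lemma green_le_of_UE:
  assumes UE
  obtains G where "G > 0"
    "\<And>x z R. R > 0 \<Longrightarrow> z \<in> gball x R \<Longrightarrow> R / 4 \<le> real (gdist x z) \<Longrightarrow>
      green (gball x R) x z \<le> G * tau x R / V x R * mu z"
proof -
  obtain CU \<beta> c where CU: "CU > 0" and \<beta>: "\<beta> > 1" and c: "c > 0" and ue: "\<forall>x y. \<forall>n>0. p n x y \<le> CU / V x (real (e x n)) *
       exp (- c * (enn2real (E x (real (gdist x y))) / real n) powr (1 / (\<beta> - 1)))"
    using assms unfolding UE_def by blast
  define \<eta> where "\<eta> = 1 / (\<beta> - 1)"
  have \<eta>: "\<eta> > 0" using \<beta> by (simp add: \<eta>_def)
  have UE': "p n x y \<le> CU / phi x n * exp (- c * (tau x (real (gdist x y)) / real n) powr \<eta>)" if "n \<ge> 1" for n x y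
    using ue[rule_format, of n x y] that by (simp add: E_eq tau_nonneg phi_def \<eta>_def)
  obtain K0 \<kappa>0 where K0: "K0 \<ge> 1"
    and Vphi: "\<And>y R j. j \<ge> 1 \<Longrightarrow> V y R \<le> K0 * max 1 (tau y R / real j) ^ \<kappa>0 * phi y j"
    using V_le_phi by blast
  obtain L \<kappa> where L: "L \<ge> 1" and phi: "\<And>x z \<rho> n j. real (gdist x z) \<le> \<rho> \<Longrightarrow> j \<ge> 1 \<Longrightarrow> n \<ge> 1 \<Longrightarrow> n \<le> 3 * j \<Longrightarrow>
      phi x n \<le> L * max 1 (tau x \<rho> / real n) ^ \<kappa> * phi z j" using phi_compare by blast
  obtain K2 where K2: "K2 \<ge> 1" and absorb: "\<And>t. t \<ge> 0 \<Longrightarrow>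
      max 1 t ^ \<kappa>0 * exp (- c * t powr \<eta>) \<le> K2 * exp (- (c / 2) * t powr \<eta>)"
    using polynomial_absorbed[OF \<eta> c, of \<kappa>0] by blast
  define W where "W = CU * K0 * (C\<^sup>2) ^ \<kappa>0 * K2"
  define G where "G = CU * K0 * L + 2 * W"
  have W: "W > 0" using CU K0 C_ge_4 K2 by (simp add: W_def)
  have C2: "C\<^sup>2 \<ge> 1" using C_ge_4 by simp
  show thesis
  proof (rule that[of G])
    show "G > 0" using W CU K0 L by (simp add: G_def add_pos_pos)
    fix x z and R :: real
    assume R: "R > 0" and zB: "z \<in> gball x R" and far: "R / 4 \<le> real (gdist x z)"
    define B where "B = gball x R"
    have B: "transient B" "finite B" unfolding B_def by (auto intro: transient_gball)
    have V: "V x R > 0" by (rule V_pos[OF R])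
    have muz: "mu z > 0" by (rule mu_pos)
    have tR: "tau x R \<ge> 1" by (rule tau_ge_1[OF R])
    define n where "n = nat \<lceil>tau x R\<rceil>"
    have n: "tau x R \<le> real n" "real n \<le> 2 * tau x R" "n \<ge> 1"
      unfolding n_def using tR by linarith+
    \<comment> \<open>from time \<open>n\<close> on, the diagonal part of the estimate suffices\<close>
    have Q: "p n w z \<le> CU * K0 * L / V x R" if w: "w \<in> B" for w
    proof -
      have "p n w z \<le> CU / phi w n * exp (- c * (tau w (real (gdist w z)) / real n) powr \<eta>)" by (rule UE'[OF n(3)])
      also have "\<dots> \<le> CU / phi w n * 1" using c CU phi_pos[OF n(3), of w] by (intro mult_left_mono) auto
      finally have 1: "p n w z \<le> CU / phi w n" by simp
      have one: "max 1 (tau x R / real n) = 1" using n by (simp add: divide_le_eq)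
      have "V x R \<le> K0 * phi x n" using Vphi[OF n(3), of x R] unfolding one by simp
      also have "phi x n \<le> L * phi w n"
        using phi[of x w R n n] w n unfolding one by (simp add: B_def gball_def)
      finally have "V x R \<le> K0 * L * phi w n" using K0 by (simp add: mult.assoc)
      then have "CU / phi w n \<le> CU * K0 * L / V x R"
        using V phi_pos[OF n(3), of w] CU by (simp add: field_simps)
      with 1 show ?thesis by linarith
    qed
    have late: "kill B (k + n) x z \<le> surv B k x * (CU * K0 * L / V x R * mu z)" for k
    proof -
      have "kill B (k + n) x z = (\<Sum>w\<in>B. kill B k x w * kill B n w z)"
        by (rule kill_add[OF B(2)]) (rule kill_outside_right)
      also have "\<dots> \<le> (\<Sum>w\<in>B. kill B k x w * (CU * K0 * L / V x R * mu z))"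
      proof (intro sum_mono mult_left_mono kill_nonneg)
        fix w assume w: "w \<in> B"
        have "kill B n w z \<le> kill UNIV n w z" by (rule kill_mono_set) simp
        also have "\<dots> = p n w z * mu z" by (rule kill_UNIV_eq)
        also have "\<dots> \<le> CU * K0 * L / V x R * mu z" using Q[OF w] muz by (intro mult_right_mono) auto
        finally show "kill B n w z \<le> CU * K0 * L / V x R * mu z" .
      qed
      also have "\<dots> = surv B k x * (CU * K0 * L / V x R * mu z)"
        unfolding sum_distrib_right[symmetric]
        by (subst surv_eq_sum[OF B(2)]) (auto simp: kill_outside_right)
      finally show ?thesis .
    qed
    \<comment> \<open>before time \<open>n\<close>, the exponential factor makes up for the small volumes\<close>
    have early: "kill B k x z \<le> W / V x R * mu z" for k
    proof (cases "k = 0")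
      case True
      have "x \<noteq> z" using far R by auto
      then have "kill B k x z = 0" using True by (simp add: kill_0)
      then show ?thesis using W V muz by simp
    next
      case False
      then have k: "k \<ge> 1" by simp
      define t where "t = tau x (real (gdist x z)) / real k"
      have t0: "t \<ge> 0" using tau_nonneg by (simp add: t_def)
      have ph: "phi x k > 0" by (rule phi_pos[OF k])
      have "tau x R \<le> C ^ 2 * tau x (R / 4)" using tau_power[of "R / 4" x 2] R by simp
      also have "\<dots> \<le> C ^ 2 * tau x (real (gdist x z))" using far by (intro mult_left_mono tau_mono) auto
      finally have "tau x R / real k \<le> C\<^sup>2 * t" using k by (simp add: t_def divide_right_mono)
      also have "\<dots> \<le> C\<^sup>2 * max 1 t" using C2 by (intro mult_left_mono) auto
      finally have "max 1 (tau x R / real k) \<le> C\<^sup>2 * max 1 t" using mult_mono[of 1 "C\<^sup>2" 1 "max 1 t"] C2 by simp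
      then have "max 1 (tau x R / real k) ^ \<kappa>0 \<le> (C\<^sup>2 * max 1 t) ^ \<kappa>0" by (intro power_mono) auto
      then have "K0 * max 1 (tau x R / real k) ^ \<kappa>0 * phi x k \<le> K0 * (C\<^sup>2 * max 1 t) ^ \<kappa>0 * phi x k"
        using K0 ph by (intro mult_right_mono mult_left_mono) auto
      then have VR: "V x R \<le> K0 * (C\<^sup>2 * max 1 t) ^ \<kappa>0 * phi x k"
        using Vphi[OF k, of x R] by linarith
      have inv: "CU / phi x k \<le> CU * (K0 * (C\<^sup>2 * max 1 t) ^ \<kappa>0) / V x R"
        using VR V ph CU by (simp add: field_simps)
      have "p k x z \<le> CU / phi x k * exp (- c * t powr \<eta>)" unfolding t_def by (rule UE'[OF k])
      also have "\<dots> \<le> CU * (K0 * (C\<^sup>2 * max 1 t) ^ \<kappa>0) / V x R * exp (- c * t powr \<eta>)"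
        by (intro mult_right_mono inv) auto
      also have "\<dots> = CU * K0 * (C\<^sup>2) ^ \<kappa>0 * (max 1 t ^ \<kappa>0 * exp (- c * t powr \<eta>)) / V x R"
        by (simp add: power_mult_distrib mult_ac)
      also have "\<dots> \<le> CU * K0 * (C\<^sup>2) ^ \<kappa>0 * K2 / V x R"
      proof (intro divide_right_mono mult_left_mono)
        have "max 1 t ^ \<kappa>0 * exp (- c * t powr \<eta>) \<le> K2 * exp (- (c / 2) * t powr \<eta>)" by (rule absorb[OF t0])
        also have "\<dots> \<le> K2 * 1" using K2 c by (intro mult_left_mono) auto
        finally show "max 1 t ^ \<kappa>0 * exp (- c * t powr \<eta>) \<le> K2" by simp
      qed (use V CU K0 C_ge_4 in auto)
      finally have pk: "p k x z \<le> W / V x R" by (simp add: W_def)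
      have "kill B k x z \<le> kill UNIV k x z" by (rule kill_mono_set) simp
      also have "\<dots> = p k x z * mu z" by (rule kill_UNIV_eq)
      also have "\<dots> \<le> W / V x R * mu z" using pk muz by (intro mult_right_mono) auto
      finally show ?thesis .
    qed
    have summ: "summable (\<lambda>k. kill B k x z)" by (rule transient_summable_kill[OF B(1)])
    have split: "green B x z = (\<Sum>k. kill B (k + n) x z) + (\<Sum>k<n. kill B k x z)"
      unfolding green_def by (rule suminf_split_initial_segment[OF summ])
    have sumsurv: "summable (\<lambda>k. surv B k x)" by (rule transient_summable[OF B(1)])
    have "(\<Sum>k. kill B (k + n) x z) \<le> (\<Sum>k. surv B k x * (CU * K0 * L / V x R * mu z))"
      by (rule suminf_le[OF late summable_ignore_initial_segment[OF summ] summable_mult2[OF sumsurv]])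
    also have "\<dots> = (\<Sum>k. surv B k x) * (CU * K0 * L / V x R * mu z)"
      by (rule suminf_mult2[OF sumsurv, symmetric])
    also have "(\<Sum>k. surv B k x) = tau x R" by (simp add: tau_def mean_exit_def B_def)
    finally have late_sum: "(\<Sum>k. kill B (k + n) x z) \<le> tau x R * (CU * K0 * L / V x R * mu z)" .
    have "(\<Sum>k<n. kill B k x z) \<le> (\<Sum>k<n. W / V x R * mu z)" by (intro sum_mono early)
    also have "\<dots> = real n * (W / V x R * mu z)" by simp
    also have "\<dots> \<le> 2 * tau x R * (W / V x R * mu z)" using n W V muz by (intro mult_right_mono) auto
    finally have "green B x z \<le> tau x R * (CU * K0 * L / V x R * mu z) + 2 * tau x R * (W / V x R * mu z)"
      using split late_sum by linarith
    also have "\<dots> = G * tau x R / V x R * mu z" using V by (simp add: G_def field_simps)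
    finally show "green (gball x R) x z \<le> G * tau x R / V x R * mu z" by (simp add: B_def)
  qed
qed

lemma vclosure_subset: "A \<subseteq> B \<Longrightarrow> vclosure A \<subseteq> vclosure B"
  by (auto simp: vclosure_def)

text \<open>The potential is the function that equals \<open>u\<close> on \<open>K\<close>, vanishes outside \<open>B\<close> and is harmonic in
  between; the maximum principle in \<open>B - K\<close> puts it below \<open>u\<close>.  Where it is smaller than \<open>u\<close> at some
  neighbour, replacing \<open>u\<close> by it leaves a positive charge, which is possible only on the inner
  boundary of \<open>K\<close>.\<close>

lemma reduced_potential:
  assumes B: "transient B" and KB: "K \<subseteq> B"
    and harm: "\<And>y. y \<in> B \<Longrightarrow> step u y = u y"
    and nonneg: "\<And>y. y \<in> vclosure B \<Longrightarrow> 0 \<le> u y"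
  obtains \<nu> where "\<And>y. y \<in> B \<Longrightarrow> 0 \<le> \<nu> y"
    "\<And>y. y \<in> B \<Longrightarrow> \<nu> y \<noteq> 0 \<Longrightarrow> y \<in> K \<and> \<not> nbr y \<subseteq> K"
    "\<And>y. y \<in> K \<Longrightarrow> green_op B \<nu> y = u y" "\<And>y. y \<in> B \<Longrightarrow> green_op B \<nu> y \<le> u y"
proof -
  define A where "A = B - K"
  have A: "transient A" by (rule transient_subset[OF B]) (auto simp: A_def)
  define v where "v y = (if y \<in> K then u y else 0)" for y
  define w where "w y = v y + green_op A (step v) y" for y
  have uB: "0 \<le> u y" if "y \<in> B" for y using nonneg that by (auto simp: vclosure_def)
  have wK: "w y = u y" if "y \<in> K" for y using that by (simp add: w_def v_def A_def green_op_outside)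
  have wout: "w y = 0" if "y \<notin> B" for y using that KB by (auto simp: w_def v_def A_def green_op_outside)
  have wA: "step w y = w y" if "y \<in> A" for y
    using that unfolding w_def[abs_def] by (simp add: step_add green_op_step[OF A]) (simp add: v_def A_def)
  have w_le_B: "w y \<le> u y" if "y \<in> B" for y
  proof (cases "y \<in> K")
    case False
    then have yA: "y \<in> A" using that by (simp add: A_def)
    have "0 \<le> u y - w y"
    proof (rule max_principle[OF A _ _ yA])
      show "step (\<lambda>y. u y - w y) z \<le> u z - w z" if "z \<in> A" for z
        using that harm[of z] wA[OF that] by (simp add: step_diff A_def)
      show "0 \<le> u z - w z" if z: "z \<in> vclosure A" "z \<notin> A" for z
      proof (cases "z \<in> K")
        case False
        then have "z \<notin> B" using z by (simp add: A_def)
        moreover have "z \<in> vclosure B" using z(1) vclosure_subset[of A B] by (auto simp: A_def)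
        ultimately show ?thesis using nonneg by (simp add: wout)
      qed (simp add: wK)
    qed
    then show ?thesis by simp
  qed (simp add: wK)
  have w_le: "w y \<le> u y" if "y \<in> vclosure B" for y
    using w_le_B wout nonneg[OF that] by (cases "y \<in> B") auto
  define \<nu> where "\<nu> y = w y - step w y" for y
  have pot: "green_op B \<nu> y = w y" if "y \<in> B" for y
    unfolding \<nu>_def by (rule green_op_unique[OF B _ that, symmetric]) (simp add: wout)
  show thesis
  proof (rule that[of \<nu>])
    fix y assume y: "y \<in> B"
    show "0 \<le> \<nu> y"
    proof (cases "y \<in> K")
      case True
      have "step w y \<le> step u y"
        by (rule step_mono) (use y in \<open>auto simp: vclosure_def intro!: w_le\<close>)
      then show ?thesis using True y by (simp add: \<nu>_def wK harm)
    next
      case False then show ?thesis using y wA[of y] by (simp add: \<nu>_def A_def)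
    qed
    show "y \<in> K \<and> \<not> nbr y \<subseteq> K" if nz: "\<nu> y \<noteq> 0"
    proof
      show "y \<in> K" using nz y wA[of y] by (auto simp: \<nu>_def A_def)
      show "\<not> nbr y \<subseteq> K"
      proof
        assume sub: "nbr y \<subseteq> K"
        have "step w y = step u y" by (rule step_cong) (use sub in \<open>auto intro: wK\<close>)
        then show False using nz \<open>y \<in> K\<close> y by (simp add: \<nu>_def wK harm)
      qed
    qed
    show "green_op B \<nu> y \<le> u y" by (simp add: pot y w_le_B)
  next
    show "green_op B \<nu> y = u y" if "y \<in> K" for y using that KB by (auto simp: pot wK subset_iff)
  qed
qed

text \<open>The charge of \<open>reduced_potential\<close> for \<open>K = B(x,R/2)\<close> sits at distance at least \<open>R / 2 - 1\<close> from
  \<open>x\<close>, where the Green function bound applies as soon as \<open>R \<ge> 4\<close>.  For smaller \<open>R\<close> the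
  ball has volume comparable to \<open>mu x\<close>, and the single term \<open>u x * mu x\<close> of the sum suffices.\<close>

lemma UE_imp_MV:
  assumes UE
  shows MV
proof -
  obtain G where G: "G > 0" and green: "\<And>x z R. R > 0 \<Longrightarrow> z \<in> gball x R \<Longrightarrow> R / 4 \<le> real (gdist x z) \<Longrightarrow>
      green (gball x R) x z \<le> G * tau x R / V x R * mu z"
    using green_le_of_UE[OF assms] by blast
  define Z where "Z = max (D ^ 2) (G * C)"
  have Z: "Z > 0" using D_ge_1 by (simp add: Z_def less_max_iff_disj)
  have main: "u x \<le> Z / V x R * (\<Sum>y\<in>gball x R. u y * mu y)"
    if R: "R > 0" and harm: "harmonic_on u (gball x R)" and nonneg: "\<And>y. y \<in> vclosure (gball x R) \<Longrightarrow> 0 \<le> u y"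
    for x R u
  proof -
    define B where "B = gball x R"
    have B: "transient B" "finite B" unfolding B_def by (auto intro: transient_gball)
    have V: "V x R > 0" by (rule V_pos[OF R])
    have uB: "0 \<le> u y" if "y \<in> B" for y using nonneg that by (auto simp: vclosure_def B_def)
    have xB: "x \<in> B" using R by (simp add: B_def self_in_gball)
    define I where "I = (\<Sum>y\<in>B. u y * mu y)"
    have I0: "I \<ge> 0" unfolding I_def using uB mu_pos by (intro sum_nonneg mult_nonneg_nonneg) (auto simp: less_imp_le)
    have "u x \<le> Z / V x R * I"
    proof (cases "R \<le> 4")
      case True
      have "V x R \<le> V x (2 ^ 2 * 1)" using True by (intro V_mono) simp
      also have "\<dots> \<le> D ^ 2 * V x 1" by (rule V_power) simp
      also have "\<dots> = D ^ 2 * mu x" by (simp add: V_1)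
      also have "\<dots> \<le> Z * mu x" using mu_pos[of x] by (intro mult_right_mono) (auto simp: Z_def)
      finally have VZ: "V x R \<le> Z * mu x" .
      have "u x * mu x \<le> I" unfolding I_def
        using B xB uB mu_pos by (intro member_le_sum[of x B "\<lambda>y. u y * mu y"]) (auto intro!: mult_nonneg_nonneg simp: less_imp_le)
      then have "Z * (u x * mu x) \<le> Z * I" using Z by (intro mult_left_mono) auto
      moreover have "u x * V x R \<le> u x * (Z * mu x)" using uB[OF xB] by (intro mult_left_mono VZ)
      ultimately have "u x * V x R \<le> Z * I" by (simp add: mult_ac)
      then show ?thesis using V by (simp add: field_simps)
    next
      case False
      have KB: "gball x (R / 2) \<subseteq> B" unfolding B_def using R by (intro gball_mono) simp
      have xK: "x \<in> gball x (R / 2)" using R by (intro self_in_gball) simp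
      obtain \<nu> where \<nu>0: "\<And>y. y \<in> B \<Longrightarrow> 0 \<le> \<nu> y"
        and supp: "\<And>y. y \<in> B \<Longrightarrow> \<nu> y \<noteq> 0 \<Longrightarrow> y \<in> gball x (R / 2) \<and> \<not> nbr y \<subseteq> gball x (R / 2)"
        and eq: "\<And>y. y \<in> gball x (R / 2) \<Longrightarrow> green_op B \<nu> y = u y" and le: "\<And>y. y \<in> B \<Longrightarrow> green_op B \<nu> y \<le> u y"
        using reduced_potential[OF B(1) KB, of u] harm nonneg unfolding harmonic_on_iff B_def by blast
      define m where "m = (\<Sum>z\<in>B. mu z * \<nu> z)"
      have "u x = (\<Sum>z\<in>B. green B x z * \<nu> z)" using eq[OF xK] by (simp add: green_op_def)
      also have "\<dots> \<le> (\<Sum>z\<in>B. G * tau x R / V x R * (mu z * \<nu> z))"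
      proof (rule sum_mono)
        fix z assume z: "z \<in> B"
        show "green B x z * \<nu> z \<le> G * tau x R / V x R * (mu z * \<nu> z)"
        proof (cases "\<nu> z = 0")
          case nz: False
          then obtain y where y: "adj z y" "y \<notin> gball x (R / 2)" using supp[OF z] by auto
          have "real (gdist x y) \<le> real (gdist x z) + 1" using gdist_adj_le[OF y(1), of x] by simp
          then have "R / 4 \<le> real (gdist x z)" using y(2) False by (simp add: gball_def)
          then have "green B x z \<le> G * tau x R / V x R * mu z" using green[OF R] z by (simp add: B_def)
          then have "green B x z * \<nu> z \<le> G * tau x R / V x R * mu z * \<nu> z" using \<nu>0[OF z] by (rule mult_right_mono)
          then show ?thesis by (simp add: mult.assoc)
        qed simp
      qed
      also have "\<dots> = G / V x R * (tau x R * m)" by (simp add: m_def sum_distrib_left mult_ac)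
      also have "tau x R * m \<le> C * I"
      proof -
        have "tau x R * m = (\<Sum>z\<in>B. mu z * \<nu> z * tau x R)" by (simp add: m_def sum_distrib_left mult_ac)
        also have "\<dots> \<le> (\<Sum>z\<in>B. mu z * \<nu> z * (C * mean_exit B z))"
        proof (rule sum_mono)
          fix z assume z: "z \<in> B"
          show "mu z * \<nu> z * tau x R \<le> mu z * \<nu> z * (C * mean_exit B z)"
          proof (cases "\<nu> z = 0")
            case False
            then have zK: "z \<in> gball x (R / 2)" using supp[OF z] by blast
            have "tau x R \<le> C * tau z (R / 2)" using tau_double[of "R / 2" x z] zK R by (simp add: gball_def)
            also have "tau z (R / 2) \<le> mean_exit B z"
              unfolding tau_def B_def using zK by (intro mean_exit_mono_set transient_gball gball_subset) (simp add: gball_def)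
            finally show ?thesis using \<nu>0[OF z] mu_pos[of z] C_ge_4 by (intro mult_left_mono) auto
          qed simp
        qed
        also have "\<dots> = C * (\<Sum>y\<in>B. mu y * green_op B \<nu> y)"
          unfolding sum_mu_green_op[OF B(1)] by (simp add: sum_distrib_left mult_ac)
        also have "\<dots> \<le> C * I"
          unfolding I_def using le mu_pos C_ge_4
          by (intro mult_left_mono sum_mono) (auto simp: mult.commute less_imp_le)
        finally show ?thesis .
      qed
      finally have "u x \<le> G / V x R * (C * I)" using G V by (simp add: mult_left_mono divide_right_mono)
      also have "\<dots> = G * C / V x R * I" by simp
      also have "\<dots> \<le> Z / V x R * I" using I0 V by (intro mult_right_mono divide_right_mono) (auto simp: Z_def)
      finally show ?thesis .
    qed
    then show ?thesis by (simp add: I_def B_def)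
  qed
  show MV
    unfolding MV_def
  proof (intro exI[of _ Z] conjI allI impI Z)
    fix x and R :: real and u assume "R > 0" "harmonic_on u (gball x R) \<and> (\<forall>y\<in>vclosure (gball x R). 0 \<le> u y)"
    then show "u x \<le> Z / V x R * (\<Sum>\<^sub>\<infinity>y\<in>gball x R. u y * mu y)" using main[of R u x] by simp
  qed
qed

end

theorem theorem1p1:
  fixes adj :: "'a \<Rightarrow> 'a \<Rightarrow> bool" and weight :: "'a \<Rightarrow> 'a \<Rightarrow> real"
  assumes "weighted_graph adj weight"
    and "weighted_graph.p0 adj weight"
    and "weighted_graph.VD adj weight"
    and "weighted_graph.TC adj weight"
  shows "(weighted_graph.MV adj weight \<longleftrightarrow> weighted_graph.DUE adj weight) \<and>
    (weighted_graph.DUE adj weight \<longleftrightarrow> weighted_graph.UE adj weight)"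
proof -
  interpret weighted_graph adj weight by (rule assms(1))
  obtain c0 where c0: "c0 > 0" "\<forall>x y. adj x y \<longrightarrow> weight x y / mu x \<ge> c0"
    using assms(2) unfolding p0_def by blast
  obtain D where D: "\<forall>x. \<forall>R>0. V x (2 * R) \<le> D * V x R"
    using assms(3) unfolding VD_def by blast
  obtain C where C: "\<forall>x. \<forall>R>0. \<forall>y\<in>gball x R. E x (2 * R) / E y R \<le> ennreal C"
    using assms(4) unfolding TC_def by blast
  \<comment> \<open>a constant of at least four gives the scales \<open>(C / 2) ^ k\<close> in \<open>exit_tail\<close> a ratio of at least two\<close>
  interpret doubling_graph adj weight c0 D "max C 4"
  proof
    show "E x (2 * R) / E y R \<le> ennreal (max C 4)" if "R > 0" "y \<in> gball x R" for x y R
      using C[rule_format, OF that] by (rule order_trans) (simp add: ennreal_leI)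
  qed (use c0 D in auto)
  show ?thesis
    using MV_imp_DUE DUE_imp_UE UE_imp_DUE UE_imp_MV by blast
qed

end
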